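(* Let $\delta\geq 2$. The flow $x\mapsto \rho^x_t$ of $\mathrm{BES}^x(\delta)$ processes has, $P$-a.s., derivatives of all orders with respect to $x$ for $x>0$, and these derivatives are bicontinuous in $(x,t)$ on the set $]0,+\infty[\,\times[0,+\infty[$.
   Context: Let $\beta=(\beta_t)_{t\geq 0}$ be a standard Brownian motion on a probability space with probability $P$. For $\delta>1$ and $x\geq 0$, the Bessel process $\mathrm{BES}^x(\delta)$ of dimension $\delta$ starting from $x$, denoted $\rho^x=(\rho^x_t)_{t\geq 0}$, is the unique nonnegative strong solution of $$\rho^x_t=x+\beta_t+\frac{\delta-1}{2}\int_0^t\frac{1}{\rho^x_s}\,ds,\qquad t\geq 0,$$ where the same Brownian motion $\beta$ is used for all starting points $x$. The Bessel flow is the map $x\mapsto\rho^x_t$; a version of it that is bicontinuous is used. "Bicontinuous" means jointly continuous in $(x,t)$. *)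

theory Defs
  imports "HOL-Probability.Probability"
begin

text \<open>Time is modelled by \<open>real\<close>; only the values of a process at times \<open>t \<ge> 0\<close>, and
  of a flow at starting points \<open>x \<ge> 0\<close>, are constrained.\<close>

locale standard_brownian_motion = prob_space M for M :: "'a measure" +
  fixes \<beta> :: "real \<Rightarrow> 'a \<Rightarrow> real"
  assumes random_variable: "t \<ge> 0 \<Longrightarrow> random_variable borel (\<beta> t)"
    and start: "AE \<omega> in M. \<beta> 0 \<omega> = 0"
    and indep_increments:
      "\<lbrakk>0 \<le> \<tau> 0; \<And>i. i < n \<Longrightarrow> \<tau> i \<le> \<tau> (Suc i)\<rbrakk> \<Longrightarrow>
        indep_vars (\<lambda>_. borel) (\<lambda>i \<omega>. \<beta> (\<tau> (Suc i)) \<omega> - \<beta> (\<tau> i) \<omega>) {..<n::nat}"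
    and normal_increments:
      "\<lbrakk>0 \<le> s; s < t\<rbrakk> \<Longrightarrow>
        distributed M lborel (\<lambda>\<omega>. \<beta> t \<omega> - \<beta> s \<omega>) (normal_density 0 (sqrt (t - s)))"
    and continuous_paths: "AE \<omega> in M. continuous_on {0..} (\<lambda>t. \<beta> t \<omega>)"

text \<open>The natural filtration of \<open>\<beta>\<close>, augmented by all subsets of \<open>M\<close>-null sets.\<close>

definition augmented_filtration ::
    "'a measure \<Rightarrow> (real \<Rightarrow> 'a \<Rightarrow> real) \<Rightarrow> real \<Rightarrow> 'a measure" where
  "augmented_filtration M \<beta> t =
    sigma (space M)
      ({\<beta> s -` A \<inter> space M | s A. 0 \<le> s \<and> s \<le> t \<and> A \<in> sets borel} \<union> null_sets (completion M))"

text \<open>The nonnegative strong solution \<open>X\<close> of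
  \<open>X t = x + \<beta> t + (\<delta> - 1) / 2 * \<integral>\<^sub>0\<^sup>t 1 / X s ds\<close>: continuous, and adapted to the augmented
  filtration of \<open>\<beta>\<close>. In the finiteness condition \<open>inverse 0 = \<infinity>\<close> (in \<open>ennreal\<close>), so the
  time spent at \<open>0\<close> is Lebesgue-null and the convention \<open>1 / 0 = 0\<close> for reals does not
  affect the integral in the equation.\<close>

definition bessel_process ::
    "'a measure \<Rightarrow> (real \<Rightarrow> 'a \<Rightarrow> real) \<Rightarrow> real \<Rightarrow> real \<Rightarrow> (real \<Rightarrow> 'a \<Rightarrow> real) \<Rightarrow> bool" where
  "bessel_process M \<beta> \<delta> x X \<longleftrightarrow>
    (\<forall>t\<ge>0. X t \<in> borel_measurable (augmented_filtration M \<beta> t)) \<and>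
    (AE \<omega> in M. continuous_on {0..} (\<lambda>t. X t \<omega>) \<and>
      (\<forall>t\<ge>0. X t \<omega> \<ge> 0 \<and>
        (\<integral>\<^sup>+ s\<in>{0..t}. inverse (ennreal (X s \<omega>)) \<partial>lborel) < \<infinity> \<and>
        X t \<omega> = x + \<beta> t \<omega> + (\<delta> - 1) / 2 * (LBINT s:{0..t}. 1 / X s \<omega>)))"

text \<open>A bicontinuous version of the Bessel flow \<open>x \<mapsto> \<rho> x t\<close>, driven by the same \<open>\<beta>\<close> for all
  starting points \<open>x\<close>. The null set outside of which \<open>\<rho> x\<close> solves its equation may depend
  on \<open>x\<close>.\<close>

definition bicontinuous_bessel_flow ::
    "'a measure \<Rightarrow> (real \<Rightarrow> 'a \<Rightarrow> real) \<Rightarrow> real \<Rightarrow> (real \<Rightarrow> real \<Rightarrow> 'a \<Rightarrow> real) \<Rightarrow> bool" where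
  "bicontinuous_bessel_flow M \<beta> \<delta> \<rho> \<longleftrightarrow>
    (\<forall>x\<ge>0. bessel_process M \<beta> \<delta> x (\<rho> x)) \<and>
    (AE \<omega> in M. continuous_on ({0..} \<times> {0..}) (\<lambda>(x, t). \<rho> x t \<omega>))"

end

theory Submission
  imports Defs
begin

text \<open>
  Write \<open>c = (\<delta> - 1) / 2\<close>. The proof has a probabilistic half, that the process started at
  \<open>x > 0\<close> never reaches \<open>0\<close> when \<open>c \<ge> 1/2\<close>, and a pathwise half, that a flow of positive
  solutions is smooth.

  \<^emph>\<open>Smoothness of positive flows.\<close> The driving path cancels in the difference of two solutions \<open>X\<close>,
  \<open>Y\<close> started at \<open>x\<close>, \<open>y\<close>, so \<open>D = Y - X\<close> solves the linear equation \<open>D' = - c D / (X Y)\<close> and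
  \<open>Y\<^sub>t - X\<^sub>t = (y - x) exp (- c \<integral>\<^sub>0\<^sup>t ds / (X\<^sub>s Y\<^sub>s))\<close> exactly (\<open>difference_of_solutions\<close>). Letting \<open>y\<close>
  tend to \<open>x\<close> gives \<open>\<partial>\<^sub>x \<rho>\<^sup>x\<^sub>t = exp (- c \<integral>\<^sub>0\<^sup>t ds / (\<rho>\<^sup>x\<^sub>s)\<^sup>2)\<close> (\<open>positive_flow_derivative\<close>).
  The right-hand side is built from \<open>\<rho>\<close> by operations that preserve \<open>n\<close>-fold differentiability in \<open>x\<close>
  with bicontinuous derivatives, so it is as smooth as \<open>\<rho>\<close>; hence \<open>\<rho>\<close> gains one derivative, and
  by induction it has all of them (\<open>positive_flow_smooth\<close>).

  \<^emph>\<open>Not hitting \<open>0\<close>.\<close> In stochastic calculus one notes that \<open>ln \<rho>\<close> is a local submartingale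
  because its drift \<open>(c - 1/2) / \<rho>\<^sup>2\<close> is nonnegative, while it would have to reach \<open>-\<infinity>\<close> with positive
  probability if \<open>0\<close> were hit. Here the argument is carried out for the explicit Euler scheme, stopped
  once it is at most \<open>e\<close>: this is a Markov chain built from independent Gaussian increments, and the
  expectation of \<open>y\<^sup>2 - ln y\<close> along it (with the logarithm truncated near \<open>0\<close>) grows by at most
  \<open>(2 c + 1) d + O(d\<^sup>2)\<close> per step of length \<open>d\<close> (\<open>barrier_one_step\<close>). Since this function is at least
  \<open>ln (1 / e)\<close> where the chain has stopped, Markov's inequality bounds the probability of stopping before
  \<open>T\<close> by a constant over \<open>ln (1 / e)\<close>, uniformly in fine step sizes. Pathwise, if the solution falls to
  \<open>e / 2\<close> before \<open>T\<close>, then all sufficiently fine schemes stop (\<open>euler_hits_if_path_hits\<close>). Letting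
  \<open>e\<close> tend to \<open>0\<close> shows that \<open>0\<close> is almost surely not hit (\<open>bessel_process_positive\<close>).

  \<^emph>\<open>One null set.\<close> Both the equation and positivity hold outside a null set that depends on the
  starting point. They are used for positive rational starting points only and extended to all others by
  monotonicity and bicontinuity (\<open>flow_equation_from_rationals\<close>).
\<close>

section \<open>Functions that are smooth in the starting point\<close>

text \<open>The substitution \<open>s = t u\<close> turns the moving endpoint into a parameter: the integral becomes
  \<open>\<integral>\<^sub>0\<^sup>1 t f(x, t u) du\<close>, to which continuity of parameter integrals over a fixed interval applies.\<close>

lemma continuous_on_integral_upto:
  fixes f :: "real \<Rightarrow> real \<Rightarrow> real"
  assumes f: "continuous_on ({0<..} \<times> {0..}) (\<lambda>(x, t). f x t)"
  shows "continuous_on ({0<..} \<times> {0..}) (\<lambda>(x, t). integral {0..t} (f x))"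
proof -
  have c: "continuous_on (({0<..} \<times> {0..}) \<times> cbox 0 1)
      (\<lambda>(p, u). snd p * f (fst p) (snd p * u) :: real)"
    unfolding split_beta
    by (rule continuous_on_mult, intro continuous_intros)
      (rule continuous_on_compose2[OF f[unfolded split_beta], of _ "\<lambda>q. (fst (fst q), snd (fst q) * snd q)", simplified],
        auto intro!: continuous_intros)
  have "continuous_on ({0<..} \<times> {0..})
      (\<lambda>p. integral (cbox 0 1) (\<lambda>u. snd p * f (fst p) (snd p * u)))"
    by (rule integral_continuous_on_param) (rule c)
  then show ?thesis
  proof (rule continuous_on_eq)
    fix p :: "real \<times> real"
    assume "p \<in> {0<..} \<times> {0..}"
    then obtain x t where p: "p = (x, t)" "x > 0" "t \<ge> 0" by auto
    have cx: "continuous_on {0..t} (f x)"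
      by (rule continuous_on_compose2[OF f[unfolded split_beta], of _ "\<lambda>s. (x, s)", simplified])
        (use p in \<open>auto intro!: continuous_intros\<close>)
    show "integral (cbox 0 1) (\<lambda>u. snd p * f (fst p) (snd p * u))
        = (case p of (x, t) \<Rightarrow> integral {0..t} (f x))"
    proof (cases "t = 0")
      case True
      then show ?thesis using p by simp
    next
      case False
      then have t: "t > 0" using p by simp
      have "((f x) has_integral integral {0..t} (f x)) (cbox 0 t)"
        using integrable_continuous_real[OF cx] by (simp add: has_integral_integral)
      from has_integral_affinity[OF this, of t 0] t
      have "((\<lambda>u. f x (t * u)) has_integral (1 / t) * integral {0..t} (f x)) ((\<lambda>u. (1 / t) * u) ` {0..t})"
        by (simp add: inverse_eq_divide)
      moreover have "(\<lambda>u. (1 / t) * u) ` {0..t} = {0..1}"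
        using image_mult_atLeastAtMost[of "1 / t" 0 t] t by simp
      ultimately have "((\<lambda>u. f x (t * u)) has_integral (1 / t) * integral {0..t} (f x)) {0..1}"
        by simp
      from has_integral_mult_right[OF this, of t] t
      have "((\<lambda>u. t * f x (t * u)) has_integral integral {0..t} (f x)) {0..1}" by simp
      from integral_unique[OF this] show ?thesis using p by simp
    qed
  qed
qed

text \<open>The class \<open>C\<^sup>n\<close> in the first variable, with derivatives jointly continuous in both. The recursion
  through an existentially quantified derivative, rather than through iterates of \<open>deriv\<close>, lets the closure
  properties below be proved by induction without any formula for higher derivatives.\<close>

primrec space_smooth :: "nat \<Rightarrow> (real \<Rightarrow> real \<Rightarrow> real) \<Rightarrow> bool" where
  "space_smooth 0 f \<longleftrightarrow> continuous_on ({0<..} \<times> {0..}) (\<lambda>(x, t). f x t)"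
| "space_smooth (Suc n) f \<longleftrightarrow> continuous_on ({0<..} \<times> {0..}) (\<lambda>(x, t). f x t) \<and>
     (\<exists>g. (\<forall>x>0. \<forall>t\<ge>0. ((\<lambda>y. f y t) has_field_derivative g x t) (at x)) \<and> space_smooth n g)"

lemma space_smooth_continuous:
  "space_smooth n f \<Longrightarrow> continuous_on ({0<..} \<times> {0..}) (\<lambda>(x, t). f x t)"
  by (cases n) auto

lemma space_smooth_SucE:
  assumes "space_smooth (Suc n) f"
  obtains g where "\<And>x t. x > 0 \<Longrightarrow> t \<ge> 0 \<Longrightarrow> ((\<lambda>y. f y t) has_field_derivative g x t) (at x)"
    "space_smooth n g"
  using assms by auto

lemma space_smooth_SucI:
  assumes "space_smooth n g" "space_smooth 0 f"
    "\<And>x t. x > 0 \<Longrightarrow> t \<ge> 0 \<Longrightarrow> ((\<lambda>y. f y t) has_field_derivative g x t) (at x)"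
  shows "space_smooth (Suc n) f"
  using assms by auto

lemma space_smooth_Suc_imp: "space_smooth (Suc n) f \<Longrightarrow> space_smooth n f"
proof (induction n arbitrary: f)
  case 0
  then show ?case by simp
next
  case (Suc n)
  from Suc.prems obtain g where
    "\<forall>x>0. \<forall>t\<ge>0. ((\<lambda>y. f y t) has_field_derivative g x t) (at x)" "space_smooth (Suc n) g"
    by (simp only: space_smooth.simps(2)[of "Suc n"]) blast
  with Suc.IH Suc.prems show ?case
    by auto
qed

lemma space_smooth_0: "space_smooth n f \<Longrightarrow> space_smooth 0 f"
  by (simp add: space_smooth_continuous)

lemma space_smooth_add:
  "space_smooth n f \<Longrightarrow> space_smooth n g \<Longrightarrow> space_smooth n (\<lambda>x t. f x t + g x t)"
proof (induction n arbitrary: f g)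
  case 0
  then show ?case by (simp add: split_beta continuous_on_add)
next
  case (Suc n)
  obtain f' where f': "\<And>x t. x > 0 \<Longrightarrow> t \<ge> 0 \<Longrightarrow> ((\<lambda>y. f y t) has_field_derivative f' x t) (at x)"
    "space_smooth n f'"
    using Suc.prems(1) by auto
  obtain g' where g': "\<And>x t. x > 0 \<Longrightarrow> t \<ge> 0 \<Longrightarrow> ((\<lambda>y. g y t) has_field_derivative g' x t) (at x)"
    "space_smooth n g'"
    using Suc.prems(2) by auto
  show ?case
  proof (rule space_smooth_SucI)
    show "space_smooth n (\<lambda>x t. f' x t + g' x t)"
      by (rule Suc.IH) fact+
    show "space_smooth 0 (\<lambda>x t. f x t + g x t)"
      using Suc.prems[THEN space_smooth_0] by (simp add: split_beta continuous_on_add)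
  qed (intro DERIV_add f' g')
qed

lemma space_smooth_mult:
  "space_smooth n f \<Longrightarrow> space_smooth n g \<Longrightarrow> space_smooth n (\<lambda>x t. f x t * g x t)"
proof (induction n arbitrary: f g)
  case 0
  then show ?case by (simp add: split_beta continuous_on_mult)
next
  case (Suc n)
  obtain f' where f': "\<And>x t. x > 0 \<Longrightarrow> t \<ge> 0 \<Longrightarrow> ((\<lambda>y. f y t) has_field_derivative f' x t) (at x)"
    "space_smooth n f'"
    using Suc.prems(1) by auto
  obtain g' where g': "\<And>x t. x > 0 \<Longrightarrow> t \<ge> 0 \<Longrightarrow> ((\<lambda>y. g y t) has_field_derivative g' x t) (at x)"
    "space_smooth n g'"
    using Suc.prems(2) by auto
  show ?case
  proof (rule space_smooth_SucI)
    show "space_smooth n (\<lambda>x t. f' x t * g x t + g' x t * f x t)"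
      by (intro space_smooth_add Suc.IH f' g' Suc.prems[THEN space_smooth_Suc_imp])
    show "space_smooth 0 (\<lambda>x t. f x t * g x t)"
      using Suc.prems[THEN space_smooth_0] by (simp add: split_beta continuous_on_mult)
  qed (intro DERIV_mult f' g')
qed

lemma space_smooth_const: "space_smooth n (\<lambda>x t. k)"
proof (induction n arbitrary: k)
  case (Suc n)
  show ?case
    by (rule space_smooth_SucI[OF Suc.IH[of 0]]) (auto simp: split_beta)
qed (simp add: split_beta)

lemma space_smooth_exp: "space_smooth n f \<Longrightarrow> space_smooth n (\<lambda>x t. exp (f x t))"
proof (induction n arbitrary: f)
  case 0
  then show ?case by (simp add: split_beta continuous_on_exp)
next
  case (Suc n)
  obtain f' where f': "\<And>x t. x > 0 \<Longrightarrow> t \<ge> 0 \<Longrightarrow> ((\<lambda>y. f y t) has_field_derivative f' x t) (at x)"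
    "space_smooth n f'"
    using Suc.prems(1) by auto
  show ?case
  proof (rule space_smooth_SucI)
    show "space_smooth n (\<lambda>x t. exp (f x t) * f' x t)"
      by (intro space_smooth_mult Suc.IH f' Suc.prems[THEN space_smooth_Suc_imp])
    show "space_smooth 0 (\<lambda>x t. exp (f x t))"
      using Suc.prems[THEN space_smooth_0] by (simp add: split_beta continuous_on_exp)
  qed (intro DERIV_fun_exp f')
qed

lemma space_smooth_inverse:
  "space_smooth n f \<Longrightarrow> (\<And>x t. x > 0 \<Longrightarrow> t \<ge> 0 \<Longrightarrow> f x t \<noteq> 0) \<Longrightarrow>
    space_smooth n (\<lambda>x t. inverse (f x t))"
proof (induction n arbitrary: f)
  case 0
  then show ?case by (auto simp: split_beta intro!: continuous_on_inverse)
next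
  case (Suc n)
  obtain f' where f': "\<And>x t. x > 0 \<Longrightarrow> t \<ge> 0 \<Longrightarrow> ((\<lambda>y. f y t) has_field_derivative f' x t) (at x)"
    "space_smooth n f'"
    using Suc.prems(1) by auto
  have inv: "space_smooth n (\<lambda>x t. inverse (f x t))"
    by (intro Suc.IH Suc.prems(1)[THEN space_smooth_Suc_imp] Suc.prems(2))
  show ?case
  proof (rule space_smooth_SucI)
    show "space_smooth n (\<lambda>x t. (-1) * (inverse (f x t) * f' x t * inverse (f x t)))"
      by (intro space_smooth_mult inv f' space_smooth_const)
    show "space_smooth 0 (\<lambda>x t. inverse (f x t))"
      using space_smooth_0[OF inv] .
    fix x t :: real
    assume xt: "x > 0" "t \<ge> 0"
    show "((\<lambda>y. inverse (f y t)) has_field_derivative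
        (-1) * (inverse (f x t) * f' x t * inverse (f x t))) (at x)"
      using DERIV_inverse'[OF f'(1)[OF xt] Suc.prems(2)[OF xt]] by simp
  qed
qed

lemma space_smooth_continuous_section:
  assumes "space_smooth n f" "x > 0" "S \<subseteq> {0..}"
  shows "continuous_on S (f x)"
  by (rule continuous_on_compose2[OF space_smooth_continuous[OF assms(1), unfolded split_beta],
        of _ "\<lambda>s. (x, s)", simplified])
    (use assms in \<open>auto intro!: continuous_intros\<close>)

text \<open>Differentiation under the integral sign moves the \<open>x\<close>-derivative into the integrand.\<close>

lemma space_smooth_integral:
  "space_smooth n f \<Longrightarrow> space_smooth n (\<lambda>x t. integral {0..t} (f x))"
proof (induction n arbitrary: f)
  case 0
  then show ?case by (simp add: continuous_on_integral_upto)
next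
  case (Suc n)
  obtain f' where f': "\<And>x t. x > 0 \<Longrightarrow> t \<ge> 0 \<Longrightarrow> ((\<lambda>y. f y t) has_field_derivative f' x t) (at x)"
    "space_smooth n f'"
    using Suc.prems(1) by auto
  show ?case
  proof (rule space_smooth_SucI)
    show "space_smooth n (\<lambda>x t. integral {0..t} (f' x))"
      by (intro Suc.IH f')
    show "space_smooth 0 (\<lambda>x t. integral {0..t} (f x))"
      using space_smooth_continuous[OF Suc.prems] by (simp add: continuous_on_integral_upto)
    fix x t :: real
    assume xt: "x > 0" "t \<ge> 0"
    have "((\<lambda>y. integral (cbox 0 t) (f y)) has_field_derivative integral (cbox 0 t) (f' x))
        (at x within {0<..})"
    proof (rule leibniz_rule_field_derivative)
      show "((\<lambda>x. f x s) has_field_derivative f' y s) (at y within {0<..})"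
        if "y \<in> {0<..}" "s \<in> cbox 0 t" for y s
        using that by (intro has_field_derivative_at_within[OF f'(1)]) auto
      show "f y integrable_on cbox 0 t" if "y \<in> {0<..}" for y
        using that by (intro integrable_continuous space_smooth_continuous_section[OF Suc.prems]) auto
      show "continuous_on ({0<..} \<times> cbox 0 t) (\<lambda>(x, t). f' x t)"
        by (rule continuous_on_subset[OF space_smooth_continuous[OF f'(2)]]) auto
    qed (use xt in auto)
    moreover have "at x within {0<..} = at x"
      by (rule at_within_open) (use xt in auto)
    ultimately show "((\<lambda>y. integral {0..t} (f y)) has_field_derivative integral {0..t} (f' x)) (at x)"
      by simp
  qed
qed

text \<open>The witness \<open>h\<close> agrees with the iterated \<open>deriv\<close> only for \<open>x > 0\<close>; as this set is open, that is
  enough to differentiate once more. The parameter \<open>m\<close> counts the derivatives still available.\<close>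

lemma space_smooth_higher_deriv:
  assumes "space_smooth (n + m) f"
  shows "\<exists>h. space_smooth m h \<and> (\<forall>x>0. \<forall>t\<ge>0. (deriv ^^ n) (\<lambda>y. f y t) x = h x t)"
  using assms
proof (induction n arbitrary: m)
  case 0
  then show ?case by auto
next
  case (Suc n)
  then have "\<exists>h. space_smooth (Suc m) h \<and> (\<forall>x>0. \<forall>t\<ge>0. (deriv ^^ n) (\<lambda>y. f y t) x = h x t)"
    by (intro Suc.IH) simp
  then obtain h where h: "space_smooth (Suc m) h"
    "\<And>x t. x > 0 \<Longrightarrow> t \<ge> 0 \<Longrightarrow> (deriv ^^ n) (\<lambda>y. f y t) x = h x t"
    by blast
  obtain h' where h': "\<And>x t. x > 0 \<Longrightarrow> t \<ge> 0 \<Longrightarrow> ((\<lambda>y. h y t) has_field_derivative h' x t) (at x)"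
    "space_smooth m h'"
    using h(1) by auto
  have "(deriv ^^ Suc n) (\<lambda>y. f y t) x = h' x t" if xt: "x > 0" "t \<ge> 0" for x t
  proof -
    have "((deriv ^^ n) (\<lambda>y. f y t) has_field_derivative h' x t) (at x)"
      by (rule has_field_derivative_transform_within_open[OF h'(1)[OF xt], of "{0<..}"])
        (use xt h in auto)
    then show ?thesis by (simp add: DERIV_imp_deriv)
  qed
  with h'(2) show ?case by blast
qed

lemma all_space_smooth_imp_derivatives:
  assumes "\<And>n. space_smooth n f"
  shows "\<forall>n. (\<forall>x>0. \<forall>t\<ge>0. (deriv ^^ n) (\<lambda>y. f y t) field_differentiable at x) \<and>
    continuous_on ({0<..} \<times> {0..}) (\<lambda>(x, t). (deriv ^^ n) (\<lambda>y. f y t) x)"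
proof (intro allI conjI impI)
  fix n
  obtain h where h: "space_smooth 1 h"
    "\<And>x t. x > 0 \<Longrightarrow> t \<ge> 0 \<Longrightarrow> (deriv ^^ n) (\<lambda>y. f y t) x = h x t"
    using space_smooth_higher_deriv[OF assms[of "n + 1"]] by blast
  show "continuous_on ({0<..} \<times> {0..}) (\<lambda>(x, t). (deriv ^^ n) (\<lambda>y. f y t) x)"
    by (rule continuous_on_eq[OF space_smooth_continuous[OF h(1)]]) (use h in auto)
  fix x t :: real
  assume xt: "x > 0" "t \<ge> 0"
  obtain h' where "\<And>x t. x > 0 \<Longrightarrow> t \<ge> 0 \<Longrightarrow> ((\<lambda>y. h y t) has_field_derivative h' x t) (at x)"
    using h(1) by auto
  then have "((deriv ^^ n) (\<lambda>y. f y t) has_field_derivative h' x t) (at x)"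
    by (rule has_field_derivative_transform_within_open[of _ _ _ "{0<..}"])
        (use xt h in auto)
  then show "(deriv ^^ n) (\<lambda>y. f y t) field_differentiable at x"
    by (auto simp: field_differentiable_def)
qed

section \<open>Smoothness of positive flows\<close>

text \<open>The difference \<open>D = Y - X\<close> does not see \<open>b\<close>, and \<open>D' = c (1 / Y - 1 / X) = - c D / (X Y)\<close>. So
  \<open>D\<close> times the exponential of \<open>c \<integral> 1 / (X Y)\<close> has zero derivative.\<close>

lemma difference_of_solutions:
  fixes X Y b :: "real \<Rightarrow> real"
  assumes X: "continuous_on {0..} X" "\<And>t. t \<ge> 0 \<Longrightarrow> X t > 0"
      "\<And>t. t \<ge> 0 \<Longrightarrow> X t = x + b t + c * integral {0..t} (\<lambda>s. 1 / X s)"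
    and Y: "continuous_on {0..} Y" "\<And>t. t \<ge> 0 \<Longrightarrow> Y t > 0"
      "\<And>t. t \<ge> 0 \<Longrightarrow> Y t = y + b t + c * integral {0..t} (\<lambda>s. 1 / Y s)"
    and T: "T \<ge> 0"
  shows "Y T - X T = (y - x) * exp (- c * integral {0..T} (\<lambda>s. 1 / (X s * Y s)))"
proof -
  define I where "I t = integral {0..t} (\<lambda>s. 1 / (X s * Y s))" for t
  define D where "D t = y - x + c * (integral {0..t} (\<lambda>s. 1 / Y s) - integral {0..t} (\<lambda>s. 1 / X s))" for t
  have DT: "D t = Y t - X t" if "t \<ge> 0" for t
    unfolding D_def using X(3)[OF that] Y(3)[OF that] by (simp add: algebra_simps)
  have X0: "X s \<noteq> 0" "Y s \<noteq> 0" if "s \<ge> 0" for s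
    using X(2)[OF that] Y(2)[OF that] by auto
  have cX: "continuous_on {0..T} X" and cY: "continuous_on {0..T} Y"
    using X(1) Y(1) by (auto intro: continuous_on_subset)
  have "\<exists>C. \<forall>t\<in>{0..T}. D t * exp (c * I t) = C"
  proof (rule has_field_derivative_zero_constant)
    fix t
    assume t: "t \<in> {0..T}"
    have I': "(I has_real_derivative 1 / (X t * Y t)) (at t within {0..T})"
      unfolding I_def
      by (rule integral_has_real_derivative) (use t X0 in \<open>auto intro!: continuous_intros cX cY\<close>)
    have D': "(D has_real_derivative c * (1 / Y t - 1 / X t)) (at t within {0..T})"
      unfolding D_def
      by (auto intro!: derivative_eq_intros integral_has_real_derivative continuous_intros cX cY t
          simp: X0)
    have "((\<lambda>t. D t * exp (c * I t)) has_real_derivative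
        c * (1 / Y t - 1 / X t) * exp (c * I t) + exp (c * I t) * (c * (1 / (X t * Y t))) * D t)
        (at t within {0..T})"
      by (rule DERIV_mult[OF D' DERIV_chain2[OF DERIV_exp DERIV_cmult[OF I']]])
    moreover have "c * (1 / Y t - 1 / X t) * exp (c * I t) + exp (c * I t) * (c * (1 / (X t * Y t))) * D t = 0"
      using X0[of t] t by (simp add: DT field_simps)
    ultimately show "((\<lambda>t. D t * exp (c * I t)) has_real_derivative 0) (at t within {0..T})"
      by simp
  qed simp
  then have "D T * exp (c * I T) = D 0 * exp (c * I 0)"
    using T by auto
  also have "\<dots> = y - x" by (simp add: D_def I_def)
  finally have "D T = (y - x) * exp (- (c * I T))"
    by (simp add: exp_minus field_simps)
  then show ?thesis using DT[OF T] by (simp add: I_def)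
qed

text \<open>The difference quotient equals \<open>exp (- c \<integral>\<^sub>0\<^sup>t ds / (\<rho>\<^sup>x\<^sub>s \<rho>\<^sup>y\<^sub>s))\<close> by the preceding lemma, and this
  expression is continuous in \<open>y\<close>, also at \<open>y = x\<close>.\<close>

lemma positive_flow_derivative:
  fixes R :: "real \<Rightarrow> real \<Rightarrow> real" and b :: "real \<Rightarrow> real" and c :: real
  assumes cont: "continuous_on ({0<..} \<times> {0..}) (\<lambda>(x, t). R x t)"
    and pos: "\<And>x t. x > 0 \<Longrightarrow> t \<ge> 0 \<Longrightarrow> R x t > 0"
    and eq: "\<And>x t. x > 0 \<Longrightarrow> t \<ge> 0 \<Longrightarrow> R x t = x + b t + c * integral {0..t} (\<lambda>s. 1 / R x s)"
    and xt: "x > 0" "t \<ge> 0"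
  shows "((\<lambda>y. R y t) has_field_derivative
    exp (- c * integral {0..t} (\<lambda>s. inverse (R x s) * inverse (R x s)))) (at x)"
proof -
  define q where "q y = exp (- c * integral {0..t} (\<lambda>s. 1 / (R x s * R y s)))" for y
  have sec: "continuous_on {0..} (R y)" if "y > 0" for y
    using space_smooth_continuous_section[of 0 R y] cont that by simp
  have "continuous_on ({0<..} \<times> cbox 0 t) (\<lambda>(y, s). 1 / (R x s * R y s))"
    unfolding split_beta
    by (intro continuous_intros continuous_on_compose2[OF sec[OF xt(1)], of _ snd]
         continuous_on_subset[OF cont[unfolded split_beta]])
      (use pos xt in \<open>auto simp: less_imp_neq[symmetric]\<close>)
  then have "continuous_on {0<..} (\<lambda>y. integral (cbox 0 t) (\<lambda>s. 1 / (R x s * R y s)))"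
    by (rule integral_continuous_on_param)
  then have "continuous_on {0<..} q"
    unfolding q_def by (auto intro!: continuous_intros)
  then have "isCont q x"
    using xt by (simp add: continuous_on_eq_continuous_at)
  then have lim: "(q \<longlongrightarrow> q x) (at x)"
    by (simp add: isCont_def)
  have "((\<lambda>y. (R y t - R x t) / (y - x)) \<longlongrightarrow> q x) (at x)"
  proof (rule Lim_transform_within_open[OF lim, of "{0<..}"])
    fix y
    assume y: "y \<in> {0<..}" "y \<noteq> x"
    have "R y t - R x t = (y - x) * q y"
      unfolding q_def
      by (rule difference_of_solutions) (use y xt pos eq sec in auto)
    with y show "q y = (R y t - R x t) / (y - x)" by simp
  qed (use xt in auto)
  then have "((\<lambda>y. R y t) has_field_derivative q x) (at x)"
    by (simp add: has_field_derivative_iff)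
  then show ?thesis
    unfolding q_def by (simp add: inverse_eq_divide)
qed

text \<open>Bootstrapping: the formula for the first derivative only involves \<open>R\<close> itself, so it is as smooth as
  \<open>R\<close>, which makes \<open>R\<close> one order smoother.\<close>

lemma positive_flow_smooth:
  fixes R :: "real \<Rightarrow> real \<Rightarrow> real" and b :: "real \<Rightarrow> real" and c :: real
  assumes cont: "continuous_on ({0<..} \<times> {0..}) (\<lambda>(x, t). R x t)"
    and pos: "\<And>x t. x > 0 \<Longrightarrow> t \<ge> 0 \<Longrightarrow> R x t > 0"
    and eq: "\<And>x t. x > 0 \<Longrightarrow> t \<ge> 0 \<Longrightarrow> R x t = x + b t + c * integral {0..t} (\<lambda>s. 1 / R x s)"
  shows "space_smooth n R"
proof (induction n)
  case 0
  then show ?case using cont by simp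
next
  case (Suc n)
  have inv: "space_smooth n (\<lambda>x t. inverse (R x t))"
    by (rule space_smooth_inverse[OF Suc]) (use pos in \<open>simp add: less_imp_neq[symmetric]\<close>)
  show ?case
  proof (rule space_smooth_SucI)
    show "space_smooth n (\<lambda>x t. exp (- c * integral {0..t} (\<lambda>s. inverse (R x s) * inverse (R x s))))"
      by (intro space_smooth_exp space_smooth_mult space_smooth_integral inv space_smooth_const)
    show "((\<lambda>y. R y t) has_field_derivative
        exp (- c * integral {0..t} (\<lambda>s. inverse (R x s) * inverse (R x s)))) (at x)"
      if "x > 0" "t \<ge> 0" for x t
      by (rule positive_flow_derivative[OF cont pos eq that])
  qed (use cont in simp)
qed

section \<open>A Lyapunov function for one Gaussian Euler step\<close>

text \<open>The difference of the two sides has derivative \<open>u\<^sup>3 (16 - 1 / (1 + u))\<close>, which has the sign of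
  \<open>u\<close> in the given range, so it is minimal at \<open>u = 0\<close>.\<close>

lemma minus_ln_one_plus_le:
  fixes u :: real
  assumes "u \<ge> -1/2"
  shows "- ln (1 + u) \<le> - u + u^2 / 2 - u^3 / 3 + 4 * u^4"
proof -
  \<comment> \<open>\<open>1 + v \<ge> 1/2\<close> on the whole range, so \<open>1 / (1 + v) \<le> 2 < 16\<close>.\<close>
  define g where "g v = ln (1 + v) - v + v^2 / 2 - v^3 / 3 + 4 * v^4" for v :: real
  have g': "(g has_real_derivative v^3 * (16 - 1 / (1 + v))) (at v)" if "v \<ge> -1/2" for v
    unfolding g_def using that
    by (auto intro!: derivative_eq_intros simp: field_simps power2_eq_square power3_eq_cube)
  have "g 0 \<le> g u"
  proof (cases "u \<ge> 0")
    case True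
    show ?thesis
    proof (rule DERIV_nonneg_imp_nondecreasing[of 0 u g, OF True])
      fix v assume "0 \<le> v" "v \<le> u"
      then show "\<exists>y. (g has_real_derivative y) (at v) \<and> 0 \<le> y"
        by (intro exI[of _ "v^3 * (16 - 1 / (1 + v))"] conjI g' mult_nonneg_nonneg)
          (auto simp: field_simps)
    qed
  next
    case False
    show ?thesis
    proof (rule DERIV_nonpos_imp_nonincreasing[of u 0 g])
      fix v assume v: "u \<le> v" "v \<le> 0"
      have "1 / (1 + v) \<le> 16" using v assms by (simp add: field_simps)
      moreover have "v^3 \<le> 0" using v by (simp add: power_le_zero_eq)
      ultimately show "\<exists>y. (g has_real_derivative y) (at v) \<and> y \<le> 0"
        using v assms
        by (intro exI[of _ "v^3 * (16 - 1 / (1 + v))"] conjI g' mult_nonpos_nonneg) auto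
    qed (use False in auto)
  qed
  then show ?thesis by (simp add: g_def)
qed

text \<open>A Taylor bound for \<open>- ln\<close> at \<open>y\<close> that is valid for every displacement \<open>h\<close>, however large, because the
  logarithm is truncated at \<open>e / 2\<close>. The remainder is of fourth order so that its Gaussian expectation is
  \<open>O(d\<^sup>2)\<close>. For \<open>h \<ge> - y / 2\<close> the truncation is inactive and Taylor's formula applies. Otherwise
  \<open>\<bar>h\<bar>\<close> is at least \<open>y / 2 > e / 2\<close>, and the fourth-order term alone outweighs the change of the truncated
  logarithm.\<close>

lemma minus_ln_truncated_le:
  fixes e y h :: real
  assumes e: "0 < e" and y: "e < y"
  shows "- ln (max (y + h) (e / 2)) \<le>
    - ln y - h / y + (h / y)^2 / 2 - (h / y)^3 / 3 + 32 * h^4 / e^4"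
proof (cases "h / y \<ge> -1/2")
  case True
  have y0: "y > 0" using e y by simp
  have "y + h \<ge> e / 2" using True y0 y by (simp add: field_simps)
  then have "max (y + h) (e / 2) = y * (1 + h / y)" using y0 by (simp add: field_simps)
  moreover have "1 + h / y > 0" using True by linarith
  ultimately have "- ln (max (y + h) (e / 2)) = - ln y - ln (1 + h / y)"
    using y0 by (simp add: ln_mult)
  also have "\<dots> \<le> - ln y - h / y + (h / y)^2 / 2 - (h / y)^3 / 3 + 4 * (h / y)^4"
    using minus_ln_one_plus_le[OF True] by simp
  also have "4 * (h / y)^4 \<le> 32 * h^4 / e^4"
  proof -
    have "(h / y)^4 \<le> h^4 / e^4"
      unfolding power_divide using e y by (intro divide_left_mono power_mono) auto
    moreover have "h^4 / e^4 \<ge> 0" "32 * h^4 / e^4 = 32 * (h^4 / e^4)" by simp_all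
    ultimately show ?thesis by linarith
  qed
  finally show ?thesis by simp
next
  case False
  have y0: "y > 0" using e y by simp
  have hy: "h / y < -1/2" using False by simp
  have "- ln (max (y + h) (e / 2)) \<le> - ln (e / 2)" using e by simp
  also have "- ln (e / 2) = - ln y + ln (2 * y / e)"
    using e y0 by (simp add: ln_div ln_mult)
  also have "ln (2 * y / e) \<le> 2 * (y / e)"
    using ln_bound[of "2 * y / e"] e y0 by simp
  also have "\<dots> \<le> 2 * (y / e)^4"
    using self_le_power[of "y / e" 4] e y by simp
  also have "\<dots> \<le> 32 * h^4 / e^4"
  proof -
    have "y / 2 \<le> - h" using hy y0 by (simp add: field_simps)
    then have "(y / 2)^4 \<le> (- h)^4" using y0 by (intro power_mono) auto
    then show ?thesis using e by (simp add: field_simps)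
  qed
  finally have "- ln (max (y + h) (e / 2)) \<le> - ln y + 32 * h^4 / e^4" by simp
  moreover have "0 \<le> - (h / y) + (h / y)^2 / 2 - (h / y)^3 / 3"
  proof -
    have "(h / y)^3 \<le> 0" using hy by (simp add: power_le_zero_eq)
    moreover have "(h/y)^2 \<ge> 0" by simp
    ultimately show ?thesis using hy by linarith
  qed
  ultimately show ?thesis by linarith
qed

text \<open>The Lyapunov function. The term \<open>- ln y\<close> makes small values expensive, \<open>y\<^sup>2\<close> keeps the function nonnegative
  for large \<open>y\<close>, and the truncation at \<open>e / 2\<close> makes it finite at the points below \<open>e\<close>, possibly negative
  ones, to which the last step of the scheme may jump.\<close>

definition barrier :: "real \<Rightarrow> real \<Rightarrow> real" where
  "barrier e y = y\<^sup>2 - ln (max y (e / 2))"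

definition euler_step :: "real \<Rightarrow> real \<Rightarrow> real \<Rightarrow> real \<Rightarrow> real \<Rightarrow> real" where
  "euler_step c d e y z = (if y \<le> e then y else y + c * d / y + z)"

lemma barrier_nonneg:
  assumes "0 < e" "e \<le> 1"
  shows "barrier e y \<ge> 0"
proof (cases "y \<ge> e / 2")
  case True
  then have "ln y \<le> y - 1" using assms by (intro ln_le_minus_one) auto
  also have "\<dots> \<le> y^2" using zero_le_power2[of "y - 1/2"] by (simp add: power2_eq_square algebra_simps)
  finally show ?thesis using True by (simp add: barrier_def)
next
  case False
  then have "ln (max y (e/2)) \<le> 0" using assms by simp
  moreover have "y\<^sup>2 \<ge> 0" by simp
  ultimately show ?thesis unfolding barrier_def by linarith
qed

lemma barrier_ge:
  assumes "0 < e" "y \<le> e"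
  shows "barrier e y \<ge> - ln e"
proof -
  have "ln (max y (e/2)) \<le> ln e" using assms by simp
  moreover have "y\<^sup>2 \<ge> 0" by simp
  ultimately show ?thesis unfolding barrier_def by linarith
qed

lemma normal_quartic_nn_integral:
  assumes d: "d > 0" and p: "\<And>z. p z = a0 + a1 * z + a2 * z^2 + a3 * z^3 + a4 * z^4"
    and nn: "\<And>z::real. p z \<ge> 0"
  shows "(\<integral>\<^sup>+z. ennreal (p z) \<partial>density lborel (normal_density 0 (sqrt d)))
    = ennreal (a0 + a2 * d + 3 * a4 * d^2)"
proof -
  let ?n = "normal_density 0 (sqrt d)"
  have m: "has_bochner_integral lborel (\<lambda>z. ?n z * 1) 1"
    "has_bochner_integral lborel (\<lambda>z. ?n z * z) 0"
    "has_bochner_integral lborel (\<lambda>z. ?n z * z^2) d"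
    "has_bochner_integral lborel (\<lambda>z. ?n z * z^3) 0"
    "has_bochner_integral lborel (\<lambda>z. ?n z * z^4) (3 * d^2)"
    using normal_moment_even[of "sqrt d" 0 0] normal_moment_odd[of "sqrt d" 0 0]
      normal_moment_even[of "sqrt d" 0 1] normal_moment_odd[of "sqrt d" 0 1]
      normal_moment_even[of "sqrt d" 0 2] d
    by (simp_all add: fact_numeral power_divide)
  have "has_bochner_integral lborel (\<lambda>z. a0 * (?n z * 1) + a1 * (?n z * z) + a2 * (?n z * z^2)
      + a3 * (?n z * z^3) + a4 * (?n z * z^4)) (a0 * 1 + a1 * 0 + a2 * d + a3 * 0 + a4 * (3 * d^2))"
    by (intro has_bochner_integral_add has_bochner_integral_mult_right m)
  then have b: "has_bochner_integral lborel (\<lambda>z. ?n z * p z) (a0 + a2 * d + 3 * a4 * d^2)"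
    by (simp add: p algebra_simps)
  have pm: "p \<in> borel_measurable borel"
    unfolding p by measurable
  have "(\<integral>\<^sup>+z. ennreal (p z) \<partial>density lborel ?n) = (\<integral>\<^sup>+z. ennreal (?n z * p z) \<partial>lborel)"
    using pm by (subst nn_integral_density) (auto simp: ennreal_mult' nn)
  also have "\<dots> = ennreal (a0 + a2 * d + 3 * a4 * d^2)"
    using b by (subst nn_integral_eq_integral)
      (auto simp: has_bochner_integral_iff nn normal_density_nonneg)
  finally show ?thesis .
qed

lemma barrier_measurable[measurable]: "barrier e \<in> borel_measurable borel"
  unfolding barrier_def by measurable

lemma euler_step_measurable[measurable]:
  "(\<lambda>(y, z). euler_step c d e y z) \<in> borel_measurable (borel \<Otimes>\<^sub>M borel)"
  unfolding euler_step_def by measurable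

text \<open>The coefficient of \<open>d\<^sup>2\<close> that collects the higher-order terms of one step.\<close>

definition euler_error :: "real \<Rightarrow> real \<Rightarrow> real" where
  "euler_error c e = c^2 / e^2 + c^2 / (2 * e^4) + 32 * (c^4 / e^4 + 6 * c^2 / e^2 + 3) / e^4"

text \<open>The discrete form of the fact that \<open>ln \<rho>\<close> is a submartingale for \<open>c \<ge> 1/2\<close>. The step from \<open>y > e\<close> is
  Gaussian with mean \<open>y + m\<close>, where \<open>m = c d / y\<close>, and variance \<open>d\<close>. To first order in \<open>d\<close> the logarithmic
  part contributes \<open>- m / y + d / (2 y\<^sup>2) = (1/2 - c) d / y\<^sup>2 \<le> 0\<close>, the quadratic part contributes
  \<open>(2 c + 1) d\<close>, and the third-order term of the Taylor bound has nonpositive expectation.\<close>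

lemma barrier_one_step:
  assumes e: "0 < e" "e \<le> 1" and c: "c \<ge> 1/2" and d: "0 < d" "d \<le> 1"
  shows "(\<integral>\<^sup>+z. ennreal (barrier e (euler_step c d e y z)) \<partial>density lborel (normal_density 0 (sqrt d)))
    \<le> ennreal (barrier e y) + ennreal ((2 * c + 1) * d + euler_error c e * d^2)"
proof (cases "y \<le> e")
  case True
  interpret prob_space "density lborel (normal_density 0 (sqrt d))"
    using d by (intro prob_space_normal_density) auto
  show ?thesis using True emeasure_space_1 by (simp add: euler_step_def)
next
  case False
  then have y: "y > e" "y > 0" using e by auto
  define m where "m = c * d / y"
  \<comment> \<open>The Taylor bound for the step with noise \<open>z\<close>, a quartic polynomial in \<open>z\<close>.\<close>
  define p where "p z = (y + m + z)^2 - ln y - (m + z) / y + ((m + z) / y)^2 / 2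
    - ((m + z) / y)^3 / 3 + 32 * (m + z)^4 / e^4" for z
  have le: "barrier e (euler_step c d e y z) \<le> p z" for z
    using minus_ln_truncated_le[OF e(1) y(1), of "m + z"] False
    by (simp add: barrier_def euler_step_def p_def m_def add.assoc)
  have "(\<integral>\<^sup>+z. ennreal (barrier e (euler_step c d e y z)) \<partial>density lborel (normal_density 0 (sqrt d)))
    \<le> (\<integral>\<^sup>+z. ennreal (p z) \<partial>density lborel (normal_density 0 (sqrt d)))"
    by (intro nn_integral_mono ennreal_leI le)
  also have "\<dots> = ennreal (((y + m)^2 - ln y - m / y + m^2 / (2 * y^2) - m^3 / (3 * y^3) + 32 * m^4 / e^4)
      + (1 + 1 / (2 * y^2) - m / y^3 + 32 * 6 * m^2 / e^4) * d + 3 * (32 / e^4) * d^2)"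
  proof (rule normal_quartic_nn_integral[OF d(1)])
    show "p z \<ge> 0" for z
      using le[of z] barrier_nonneg[OF e, of "euler_step c d e y z"] by linarith
    show "p z = ((y + m)^2 - ln y - m / y + m^2 / (2 * y^2) - m^3 / (3 * y^3) + 32 * m^4 / e^4)
      + (2 * (y + m) - 1 / y + m / y^2 - m^2 / y^3 + 32 * 4 * m^3 / e^4) * z
      + (1 + 1 / (2 * y^2) - m / y^3 + 32 * 6 * m^2 / e^4) * z^2
      + (- 1 / (3 * y^3) + 32 * 4 * m / e^4) * z^3 + 32 / e^4 * z^4" for z
      unfolding p_def using y e by (simp add: field_simps power2_eq_square power3_eq_cube power4_eq_xxxx)
  qed
  also have "\<dots> \<le> ennreal (barrier e y + ((2 * c + 1) * d + euler_error c e * d^2))"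
  proof (rule ennreal_leI)
    have m0: "m \<ge> 0" using c d y by (simp add: m_def)
    have m1: "m \<le> c * d / e" unfolding m_def using c d y e by (intro divide_left_mono) auto
    have m2: "m^2 \<le> c^2 / e^2 * d^2"
      using power_mono[OF m1 m0, of 2] by (simp add: power_mult_distrib power_divide)
    have m4: "m^4 \<le> c^4 / e^4 * d^2"
    proof -
      have "m^4 \<le> c^4 / e^4 * d^4"
        using power_mono[OF m1 m0, of 4] by (simp add: power_mult_distrib power_divide)
      also have "\<dots> \<le> c^4 / e^4 * d^2"
        using d by (intro mult_left_mono power_decreasing) auto
      finally show ?thesis .
    qed
    have m2d: "m^2 * d \<le> c^2 / e^2 * d^2"
    proof -
      have "m^2 * d \<le> m^2 * 1" using d by (intro mult_left_mono) auto
      with m2 show ?thesis by simp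
    qed
    have a1: "m^2 / (2 * y^2) \<le> c^2 / (2 * e^4) * d^2"
    proof -
      have "m^2 / (2 * y^2) \<le> m^2 / (2 * e^2)"
        using y e by (intro divide_left_mono mult_left_mono power_mono) auto
      also have "\<dots> \<le> (c^2 / e^2 * d^2) / (2 * e^2)"
        using e by (intro divide_right_mono m2) auto
      finally show ?thesis by (simp add: field_simps power2_eq_square power4_eq_xxxx)
    qed
    have a2: "- m / y + 1 / (2 * y^2) * d \<le> 0"
    proof -
      have "- m / y + 1 / (2 * y^2) * d = (1/2 - c) * (d / y^2)"
        using y by (simp add: m_def field_simps power2_eq_square)
      also have "\<dots> \<le> 0" using c d by (intro mult_nonpos_nonneg) auto
      finally show ?thesis .
    qed
    have a3: "m^3 / (3 * y^3) \<ge> 0" "m / y^3 * d \<ge> 0" using m0 y d by auto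
    have a4: "32 * m^4 / e^4 + 32 * 6 * (m^2 * d) / e^4 + 3 * (32 / e^4) * d^2
      \<le> 32 * (c^4 / e^4 + 6 * c^2 / e^2 + 3) / e^4 * d^2"
    proof -
      have "m^4 + 6 * (m^2 * d) + 3 * d^2 \<le> (c^4 / e^4 + 6 * c^2 / e^2 + 3) * d^2"
        using m4 m2d by (simp add: algebra_simps)
      then have "32 / e^4 * (m^4 + 6 * (m^2 * d) + 3 * d^2)
          \<le> 32 / e^4 * ((c^4 / e^4 + 6 * c^2 / e^2 + 3) * d^2)"
        using e by (intro mult_left_mono) auto
      then show ?thesis by (simp add: algebra_simps add_divide_distrib)
    qed
    have a5: "(y + m)^2 = y^2 + 2 * c * d + m^2"
      using y by (simp add: m_def field_simps power2_eq_square)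
    have "((y + m)^2 - ln y - m / y + m^2 / (2 * y^2) - m^3 / (3 * y^3) + 32 * m^4 / e^4)
      + (1 + 1 / (2 * y^2) - m / y^3 + 32 * 6 * m^2 / e^4) * d + 3 * (32 / e^4) * d^2
      = y^2 - ln y + (2 * c + 1) * d + m^2 + m^2 / (2 * y^2) + (- m / y + 1 / (2 * y^2) * d)
        - m^3 / (3 * y^3) - m / y^3 * d
        + (32 * m^4 / e^4 + 32 * 6 * (m^2 * d) / e^4 + 3 * (32 / e^4) * d^2)"
      unfolding a5 by (simp add: algebra_simps)
    also have "\<dots> \<le> y^2 - ln y + (2 * c + 1) * d + c^2 / e^2 * d^2 + c^2 / (2 * e^4) * d^2
        + 32 * (c^4 / e^4 + 6 * c^2 / e^2 + 3) / e^4 * d^2"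
      using m2 a1 a2 a3 a4 by linarith
    also have "\<dots> = barrier e y + ((2 * c + 1) * d + euler_error c e * d^2)"
      using y e by (simp add: barrier_def euler_error_def max_def distrib_right)
    finally show "((y + m)^2 - ln y - m / y + m^2 / (2 * y^2) - m^3 / (3 * y^3) + 32 * m^4 / e^4)
      + (1 + 1 / (2 * y^2) - m / y^3 + 32 * 6 * m^2 / e^4) * d + 3 * (32 / e^4) * d^2
      \<le> barrier e y + ((2 * c + 1) * d + euler_error c e * d^2)" .
  qed
  also have "\<dots> = ennreal (barrier e y) + ennreal ((2 * c + 1) * d + euler_error c e * d^2)"
    using barrier_nonneg[OF e, of y] c d e by (intro ennreal_plus) (auto simp: euler_error_def)
  finally show ?thesis .
qed

section \<open>The stopped Euler scheme driven by Brownian increments\<close>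

primrec stopped_euler :: "real \<Rightarrow> real \<Rightarrow> real \<Rightarrow> real \<Rightarrow> (nat \<Rightarrow> real) \<Rightarrow> nat \<Rightarrow> real" where
  "stopped_euler c d e x w 0 = x"
| "stopped_euler c d e x w (Suc k) = euler_step c d e (stopped_euler c d e x w k) (w k)"

lemma stopped_euler_cong:
  "(\<And>i. i < k \<Longrightarrow> w i = w' i) \<Longrightarrow> stopped_euler c d e x w k = stopped_euler c d e x w' k"
  by (induction k) auto

lemma stopped_euler_measurable:
  "{..<k} \<subseteq> I \<Longrightarrow> (\<lambda>w. stopped_euler c d e x w k) \<in> borel_measurable (PiM I (\<lambda>_. borel))"
proof (induction k)
  case (Suc k)
  then have "{..<k} \<subseteq> I" by auto
  with Suc have [measurable]: "(\<lambda>w. stopped_euler c d e x w k) \<in> borel_measurable (PiM I (\<lambda>_. borel))"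
    "(\<lambda>w. w k) \<in> borel_measurable (PiM I (\<lambda>_. borel))"
    by (auto intro!: measurable_component_singleton)
  show ?case
    unfolding stopped_euler.simps euler_step_def by measurable
qed simp

lemma stopped_euler_absorbed:
  assumes "stopped_euler c d e x w k \<le> e" "k \<le> n"
  shows "stopped_euler c d e x w n \<le> e"
  using assms(2) by (induction n rule: dec_induct) (auto simp: euler_step_def assms(1))

text \<open>Fubini's theorem in the form of conditioning on \<open>X\<close>.\<close>

lemma (in prob_space) nn_integral_indep_le:
  fixes X Z :: "'a \<Rightarrow> real"
  assumes ind: "indep_var borel X borel Z"
    and g[measurable]: "g \<in> borel_measurable (borel \<Otimes>\<^sub>M borel)"
    and h[measurable]: "h \<in> borel_measurable borel"
    and le: "\<And>y. (\<integral>\<^sup>+z. g (y, z) \<partial>distr M borel Z) \<le> h y"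
  shows "(\<integral>\<^sup>+\<omega>. g (X \<omega>, Z \<omega>) \<partial>M) \<le> (\<integral>\<^sup>+\<omega>. h (X \<omega>) \<partial>M)"
proof -
  have [measurable]: "X \<in> borel_measurable M" "Z \<in> borel_measurable M"
    and eq: "distr M borel X \<Otimes>\<^sub>M distr M borel Z = distr M (borel \<Otimes>\<^sub>M borel) (\<lambda>\<omega>. (X \<omega>, Z \<omega>))"
    using ind unfolding indep_var_distribution_eq by auto
  interpret Z: prob_space "distr M borel Z" by (rule prob_space_distr) simp
  have "(\<integral>\<^sup>+\<omega>. g (X \<omega>, Z \<omega>) \<partial>M) = (\<integral>\<^sup>+p. g p \<partial>distr M (borel \<Otimes>\<^sub>M borel) (\<lambda>\<omega>. (X \<omega>, Z \<omega>)))"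
    by (subst nn_integral_distr) auto
  also have "\<dots> = (\<integral>\<^sup>+y. \<integral>\<^sup>+z. g (y, z) \<partial>distr M borel Z \<partial>distr M borel X)"
    unfolding eq[symmetric] by (subst Z.nn_integral_fst) auto
  also have "\<dots> \<le> (\<integral>\<^sup>+y. h y \<partial>distr M borel X)"
    by (intro nn_integral_mono le)
  also have "\<dots> = (\<integral>\<^sup>+\<omega>. h (X \<omega>) \<partial>M)"
    by (subst nn_integral_distr) auto
  finally show ?thesis .
qed

context standard_brownian_motion
begin

definition increment :: "real \<Rightarrow> 'a \<Rightarrow> nat \<Rightarrow> real" where
  "increment d \<omega> i = \<beta> (d * Suc i) \<omega> - \<beta> (d * i) \<omega>"

lemma increment_measurable: "d \<ge> 0 \<Longrightarrow> (\<lambda>\<omega>. increment d \<omega> i) \<in> borel_measurable M"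
  unfolding increment_def by (intro borel_measurable_diff random_variable) auto

lemma increments_indep: 
  assumes "d \<ge> 0"
  shows "indep_vars (\<lambda>_. borel) (\<lambda>i \<omega>. increment d \<omega> i) {..<n}"
  unfolding increment_def
  by (rule indep_increments[of "\<lambda>i. d * real i" n]) (use assms in \<open>auto intro: mult_left_mono\<close>)

lemma increment_distr:
  assumes "d > 0"
  shows "distr M borel (\<lambda>\<omega>. increment d \<omega> i) = density lborel (normal_density 0 (sqrt d))"
proof -
  have "distributed M lborel (\<lambda>\<omega>. increment d \<omega> i) (normal_density 0 (sqrt (d * Suc i - d * i)))"
    unfolding increment_def using assms by (intro normal_increments) auto
  then have "distributed M lborel (\<lambda>\<omega>. increment d \<omega> i) (normal_density 0 (sqrt d))"
    by (simp add: algebra_simps)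
  from distributed_distr_eq_density[OF this]
  show ?thesis by (simp cong: distr_cong)
qed

text \<open>The state after \<open>k\<close> steps is a function of the first \<open>k\<close> increments, which are independent of the next.\<close>

lemma euler_indep_increment:
  assumes d: "d \<ge> 0"
  shows "indep_var borel (\<lambda>\<omega>. stopped_euler c d e x (increment d \<omega>) k) borel (\<lambda>\<omega>. increment d \<omega> k)"
proof -
  have "indep_var (PiM {..<k} (\<lambda>_. borel)) (\<lambda>\<omega>. restrict (\<lambda>i. increment d \<omega> i) {..<k})
     (PiM {k} (\<lambda>_. borel)) (\<lambda>\<omega>. restrict (\<lambda>i. increment d \<omega> i) {k})"
    by (rule indep_var_restrict[OF increments_indep[OF d, of "Suc k"]]) auto
  from indep_var_compose[OF this stopped_euler_measurable[OF subset_refl] measurable_component_singleton[of k]]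
  have "indep_var borel ((\<lambda>w. stopped_euler c d e x w k) \<circ> (\<lambda>\<omega>. restrict (\<lambda>i. increment d \<omega> i) {..<k}))
    borel ((\<lambda>w. w k) \<circ> (\<lambda>\<omega>. restrict (\<lambda>i. increment d \<omega> i) {k}))" by simp
  moreover have "(\<lambda>w. stopped_euler c d e x w k) \<circ> (\<lambda>\<omega>. restrict (\<lambda>i. increment d \<omega> i) {..<k})
      = (\<lambda>\<omega>. stopped_euler c d e x (increment d \<omega>) k)"
    by (auto simp: fun_eq_iff intro!: stopped_euler_cong)
  moreover have "(\<lambda>w. w k) \<circ> (\<lambda>\<omega>. restrict (\<lambda>i. increment d \<omega> i) {k}) = (\<lambda>\<omega>. increment d \<omega> k)"
    by (auto simp: fun_eq_iff)
  ultimately show ?thesis by simp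
qed

lemma euler_random_variable:
  assumes d: "d \<ge> 0"
  shows "(\<lambda>\<omega>. stopped_euler c d e x (increment d \<omega>) k) \<in> borel_measurable M"
  using euler_indep_increment[OF d] by (rule indep_var_rv1)

lemma barrier_expectation:
  assumes e: "0 < e" "e \<le> 1" and c: "c \<ge> 1/2" and d: "0 < d" "d \<le> 1"
  shows "(\<integral>\<^sup>+\<omega>. ennreal (barrier e (stopped_euler c d e x (increment d \<omega>) k)) \<partial>M)
    \<le> ennreal (barrier e x + k * ((2 * c + 1) * d + euler_error c e * d^2))"
proof (induction k)
  case 0
  show ?case by (simp add: emeasure_space_1)
next
  case (Suc k)
  let ?a = "(2 * c + 1) * d + euler_error c e * d^2"
  let ?Y = "\<lambda>k \<omega>. stopped_euler c d e x (increment d \<omega>) k"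
  have a: "?a \<ge> 0" using c d e by (auto simp: euler_error_def)
  have [measurable]: "?Y k \<in> borel_measurable M"
    using d by (intro euler_random_variable) auto
  have "(\<integral>\<^sup>+\<omega>. ennreal (barrier e (?Y (Suc k) \<omega>)) \<partial>M)
      = (\<integral>\<^sup>+\<omega>. (\<lambda>(y, z). ennreal (barrier e (euler_step c d e y z))) (?Y k \<omega>, increment d \<omega> k) \<partial>M)"
    by simp
  also have "\<dots> \<le> (\<integral>\<^sup>+\<omega>. (\<lambda>y. ennreal (barrier e y) + ennreal ?a) (?Y k \<omega>) \<partial>M)"
  proof (rule nn_integral_indep_le)
    show "indep_var borel (?Y k) borel (\<lambda>\<omega>. increment d \<omega> k)"
      using d by (intro euler_indep_increment) auto
    show "(\<integral>\<^sup>+z. (\<lambda>(y, z). ennreal (barrier e (euler_step c d e y z))) (y, z)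
        \<partial>distr M borel (\<lambda>\<omega>. increment d \<omega> k)) \<le> ennreal (barrier e y) + ennreal ?a" for y
      unfolding increment_distr[OF d(1)] using barrier_one_step[OF e c d] by simp
    have "(\<lambda>p. ennreal (barrier e ((\<lambda>(y, z). euler_step c d e y z) p))) \<in> borel_measurable (borel \<Otimes>\<^sub>M borel)"
      by measurable
    then show "(\<lambda>(y, z). ennreal (barrier e (euler_step c d e y z))) \<in> borel_measurable (borel \<Otimes>\<^sub>M borel)"
      by (simp add: split_beta)
  qed measurable
  also have "\<dots> = (\<integral>\<^sup>+\<omega>. ennreal (barrier e (?Y k \<omega>)) \<partial>M) + ennreal ?a"
    by (subst nn_integral_add) (auto simp: emeasure_space_1)
  also have "\<dots> \<le> ennreal (barrier e x + k * ?a) + ennreal ?a"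
    by (intro add_right_mono Suc)
  also have "\<dots> = ennreal (barrier e x + Suc k * ?a)"
  proof -
    have "k * ?a \<ge> 0" using a by (intro mult_nonneg_nonneg) auto
    then have "barrier e x + k * ?a \<ge> 0" using barrier_nonneg[OF e, of x] by linarith
    moreover have "barrier e x + Suc k * ?a = (barrier e x + k * ?a) + ?a" by (simp add: algebra_simps)
    ultimately show ?thesis using a by (simp only: ennreal_plus)
  qed
  finally show ?case .
qed

text \<open>Markov's inequality for the Lyapunov function, which is at least \<open>ln (1 / e)\<close> on the absorbing set.\<close>

lemma euler_hit_prob:
  assumes e: "0 < e" "e \<le> 1" and c: "c \<ge> 1/2" and d: "0 < d" "d \<le> 1"
  shows "ln (1 / e) * prob {\<omega>\<in>space M. stopped_euler c d e x (increment d \<omega>) k \<le> e}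
    \<le> barrier e x + k * ((2 * c + 1) * d + euler_error c e * d^2)"
proof -
  let ?Y = "\<lambda>\<omega>. stopped_euler c d e x (increment d \<omega>) k"
  let ?A = "{\<omega>\<in>space M. ?Y \<omega> \<le> e}"
  have [measurable]: "?Y \<in> borel_measurable M"
    using d by (intro euler_random_variable) auto
  have l: "ln (1 / e) \<ge> 0" using e by simp
  have "ennreal (ln (1 / e) * prob ?A) = ennreal (ln (1 / e)) * emeasure M ?A"
    using l by (simp add: emeasure_eq_measure ennreal_mult)
  also have "\<dots> = (\<integral>\<^sup>+\<omega>. ennreal (ln (1 / e)) * indicator ?A \<omega> \<partial>M)"
    by (rule nn_integral_cmult_indicator[symmetric]) measurable
  also have "\<dots> \<le> (\<integral>\<^sup>+\<omega>. ennreal (barrier e (?Y \<omega>)) \<partial>M)"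
    using barrier_ge[OF e(1)] e
    by (intro nn_integral_mono) (auto simp: indicator_def ln_div intro!: ennreal_leI)
  also have "\<dots> \<le> ennreal (barrier e x + k * ((2 * c + 1) * d + euler_error c e * d^2))"
    by (rule barrier_expectation[OF e c d])
  finally show ?thesis
    using barrier_nonneg[OF e, of x] c d e
    by (subst (asm) ennreal_le_iff) (auto simp: euler_error_def)
qed

end

section \<open>The Euler scheme follows a path down\<close>

lemma first_passage:
  fixes r :: "real \<Rightarrow> real"
  assumes cont: "continuous_on {0..T} r" and T: "T \<ge> 0" and r: "r 0 > a" "r T \<le> a"
  obtains \<tau> where "0 < \<tau>" "\<tau> \<le> T" "r \<tau> = a" "\<And>t. 0 \<le> t \<Longrightarrow> t \<le> \<tau> \<Longrightarrow> r t \<ge> a"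
proof -
  define S where "S = {0..T} \<inter> r -` {..a}"
  have "closed S"
    unfolding S_def by (rule continuous_closed_preimage[OF cont]) auto
  then have "compact S" unfolding S_def
    by (metis S_def bounded_Int bounded_closed_interval compact_eq_bounded_closed)
  moreover have "T \<in> S" using T r by (simp add: S_def)
  ultimately obtain \<tau> where \<tau>: "\<tau> \<in> S" "\<And>t. t \<in> S \<Longrightarrow> \<tau> \<le> t"
    using compact_attains_inf[of S] by blast
  have pos: "r t > a" if "0 \<le> t" "t < \<tau>" for t
    using \<tau>(2)[of t] \<tau>(1) that by (force simp: S_def)
  have \<tau>0: "\<tau> > 0" using \<tau>(1) r by (cases "\<tau> = 0") (auto simp: S_def)
  have "\<exists>t\<ge>0. t \<le> \<tau> \<and> r t = a"
    by (rule IVT2') (use \<tau> r \<tau>0 in \<open>auto simp: S_def intro: continuous_on_subset[OF cont]\<close>)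
  then obtain t where "0 \<le> t" "t \<le> \<tau>" "r t = a" by blast
  with pos[of t] have eq: "r \<tau> = a" by (cases "t = \<tau>") auto
  show ?thesis
  proof
    show "0 < \<tau>" "\<tau> \<le> T" "r \<tau> = a" using \<tau>0 \<tau>(1) eq by (auto simp: S_def)
    show "r t \<ge> a" if "0 \<le> t" "t \<le> \<tau>" for t
      using pos[of t] eq that by (cases "t = \<tau>") auto
  qed
qed

text \<open>The scheme exceeds the path by little. If it is above the path at some step, its drift is at most that of
  the path up to the oscillation \<open>\<eta>\<close> of \<open>1 / r\<close>, since the drift decreases in the position; so the excess
  grows by at most \<open>c d \<eta>\<close>. If it is below, one step can lift it above the path by no more than the drift
  \<open>c d / e\<close>. This monotonicity replaces a Gronwall estimate.\<close>

lemma euler_below_path: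
  fixes r b :: "real \<Rightarrow> real" and Y :: "nat \<Rightarrow> real" and d :: real and K :: nat
  assumes e: "e > 0" and c: "c \<ge> 0" and d: "d > 0" and \<eta>: "\<eta> \<ge> 0"
    and cont: "continuous_on {0..\<tau>} r"
    and pos: "\<And>t. 0 \<le> t \<Longrightarrow> t \<le> \<tau> \<Longrightarrow> r t > 0"
    and start: "r 0 = x" 
    and eq: "\<And>s t. 0 \<le> s \<Longrightarrow> s \<le> t \<Longrightarrow> t \<le> \<tau> \<Longrightarrow>
      r t - r s = b t - b s + c * integral {s..t} (\<lambda>u. 1 / r u)"
    and osc: "\<And>s t. 0 \<le> s \<Longrightarrow> s \<le> t \<Longrightarrow> t \<le> \<tau> \<Longrightarrow> t \<le> s + d \<Longrightarrow> 1 / r s \<le> 1 / r t + \<eta>"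
    and Y: "\<And>k. k < K \<Longrightarrow> Y k > e" "Y 0 = x"
      "\<And>k. k < K \<Longrightarrow> Y (Suc k) = Y k + c * d / Y k + (b (d * Suc k) - b (d * k))"
    and K: "d * K \<le> \<tau>" and k: "k \<le> K"
  shows "Y k \<le> r (d * k) + c * d / e + k * (c * d * \<eta>)"
  using k
proof (induction k)
  case 0
  then show ?case using start Y(2) c d e by simp
next
  case (Suc k)
  let ?s = "d * k" and ?t = "d * Suc k"
  have t: "?t \<le> \<tau>"
  proof -
    have "d * Suc k \<le> d * K" using Suc.prems d by (intro mult_left_mono) auto
    with K show ?thesis by linarith
  qed
  have st: "0 \<le> ?s" "?s \<le> ?t" "?t = ?s + d" using d by (auto simp: algebra_simps)
  have rp: "r u > 0" if "u \<in> {?s..?t}" for u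
  proof -
    have "?s \<le> u" "u \<le> ?t" using that by auto
    then show ?thesis using order_trans[OF st(1)] order_trans[OF _ t] by (intro pos) auto
  qed
  have Yk: "Y k > e" "Y k > 0" using Y(1)[of k] Suc.prems e by auto
  have ci: "continuous_on {?s..?t} (\<lambda>u. 1 / r u)"
  proof (intro continuous_intros continuous_on_subset[OF cont])
    show "{?s..?t} \<subseteq> {0..\<tau>}"
      using st(1) t by (meson atLeastatMost_subset_iff)
    show "\<forall>u\<in>{?s..?t}. r u \<noteq> 0"
      using rp by (auto simp: less_imp_neq[symmetric])
  qed
  have ii: "(\<lambda>u. 1 / r u) integrable_on {?s..?t}"
    by (rule integrable_continuous_real[OF ci])
  have r_eq: "r ?t = r ?s + (b ?t - b ?s) + c * integral {?s..?t} (\<lambda>u. 1 / r u)"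
    using eq[of ?s ?t] st t by simp
  have Y_eq: "Y (Suc k) = Y k + c * (d / Y k) + (b ?t - b ?s)"
    using Y(3)[of k] Suc.prems by simp
  have e0: "c * d * \<eta> \<ge> 0" using c d \<eta> by simp
  show ?case
  proof (cases "Y k \<ge> r ?s")
    case True
    have "integral {?s..?t} (\<lambda>u. 1 / Y k - \<eta>) \<le> integral {?s..?t} (\<lambda>u. 1 / r u)"
    proof (rule integral_le[OF _ ii])
      fix u assume u: "u \<in> {?s..?t}"
      have "1 / Y k \<le> 1 / r ?s"
        using True pos[of ?s] st t by (intro divide_left_mono) auto
      also have "\<dots> \<le> 1 / r u + \<eta>"
        using u st t by (intro osc) auto
      finally show "1 / Y k - \<eta> \<le> 1 / r u" by simp
    qed auto
    then have "d / Y k - d * \<eta> \<le> integral {?s..?t} (\<lambda>u. 1 / r u)"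
      using st by (simp add: algebra_simps)
    then have "c * (d / Y k - d * \<eta>) \<le> c * integral {?s..?t} (\<lambda>u. 1 / r u)"
      using c by (intro mult_left_mono) auto
    moreover have "c * (d / Y k - d * \<eta>) = c * (d / Y k) - c * d * \<eta>" by (simp add: algebra_simps)
    moreover have "Y k \<le> r ?s + c * d / e + k * (c * d * \<eta>)"
      using Suc by simp
    moreover have "Suc k * (c * d * \<eta>) = k * (c * d * \<eta>) + c * d * \<eta>"
      by (simp add: algebra_simps)
    ultimately show ?thesis using r_eq Y_eq by linarith
  next
    case False
    have "integral {?s..?t} (\<lambda>u. 1 / r u) \<ge> 0"
      using ii by (rule integral_nonneg) (use rp in \<open>auto intro!: less_imp_le\<close>)
    then have "c * integral {?s..?t} (\<lambda>u. 1 / r u) \<ge> 0" using c by simp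
    moreover have "c * (d / Y k) \<le> c * (d / e)"
      using c d e Yk by (intro mult_left_mono divide_left_mono) auto
    moreover have "Suc k * (c * d * \<eta>) \<ge> 0" by (intro mult_nonneg_nonneg[OF _ e0]) simp
    ultimately show ?thesis using r_eq Y_eq False by simp
  qed
qed

text \<open>Up to its first passage \<open>\<tau>\<close> at the level \<open>e / 2\<close> the path stays away from \<open>0\<close>, so \<open>r\<close> and \<open>1 / r\<close> are uniformly
  continuous there. A scheme that never stops would, at the last grid point before \<open>\<tau>\<close>, exceed the value
  \<open>e / 2\<close> by at most \<open>3 e / 8\<close>, once the step is fine; but then it is below \<open>e\<close> and has stopped.\<close>

lemma euler_hits_if_path_hits:
  fixes r b :: "real \<Rightarrow> real"
  assumes e: "0 < e" "e < x" and c: "c \<ge> 0" and T: "T > 0"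
    and cont: "continuous_on {0..} r" and start: "r 0 = x"
    and eq: "\<And>t. 0 \<le> t \<Longrightarrow> t \<le> T \<Longrightarrow> (\<And>s. 0 \<le> s \<Longrightarrow> s \<le> t \<Longrightarrow> r s > 0) \<Longrightarrow>
       r t = x + b t + c * integral {0..t} (\<lambda>u. 1 / r u)"
    and hit: "0 \<le> t0" "t0 \<le> T" "r t0 \<le> e / 2"
  shows "\<forall>\<^sub>F n in sequentially.
    stopped_euler c (T / n) e x (\<lambda>i. b (T / n * Suc i) - b (T / n * i)) n \<le> e"
proof -
  obtain \<tau> where \<tau>: "0 < \<tau>" "\<tau> \<le> t0" "r \<tau> = e / 2" and low: "\<And>t. 0 \<le> t \<Longrightarrow> t \<le> \<tau> \<Longrightarrow> r t \<ge> e / 2"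
    using first_passage[of t0 r "e / 2"] hit e start continuous_on_subset[OF cont, of "{0..t0}"] by auto
  have pos: "r t > 0" if "0 \<le> t" "t \<le> \<tau>" for t using low[OF that] e by simp
  have cr: "continuous_on {0..\<tau>} r" using cont by (rule continuous_on_subset) auto
  have ci: "continuous_on {0..\<tau>} (\<lambda>u. 1 / r u)"
    using pos by (intro continuous_intros cr) (auto simp: less_imp_neq[symmetric])
  have eq': "r t - r s = b t - b s + c * integral {s..t} (\<lambda>u. 1 / r u)"
    if "0 \<le> s" "s \<le> t" "t \<le> \<tau>" for s t
  proof -
    have "integral {0..s} (\<lambda>u. 1 / r u) + integral {s..t} (\<lambda>u. 1 / r u) = integral {0..t} (\<lambda>u. 1 / r u)"
      using that by (intro Henstock_Kurzweil_Integration.integral_combine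
        integrable_continuous_real continuous_on_subset[OF ci]) auto
    moreover have "r t = x + b t + c * integral {0..t} (\<lambda>u. 1 / r u)"
      "r s = x + b s + c * integral {0..s} (\<lambda>u. 1 / r u)"
      using that \<tau> hit by (auto intro!: eq pos)
    moreover have "c * (integral {0..s} (\<lambda>u. 1 / r u) + integral {s..t} (\<lambda>u. 1 / r u))
        = c * integral {0..s} (\<lambda>u. 1 / r u) + c * integral {s..t} (\<lambda>u. 1 / r u)"
      by (rule distrib_left)
    ultimately show ?thesis by simp
  qed
  \<comment> \<open>Oscillation \<open>\<eta>\<close> and step bound \<open>D\<close> make each of the three error terms at most \<open>e / 8\<close>.\<close>
  define \<eta> where "\<eta> = e / (8 * (c * T + 1))"
  have cT: "c * T \<ge> 0" using c T by simp
  have \<eta>: "\<eta> > 0" using e cT by (simp add: \<eta>_def)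
  have "c * T * \<eta> = (e / 8) * (c * T / (c * T + 1))" by (simp add: \<eta>_def)
  also have "\<dots> \<le> e / 8 * 1" using e cT by (intro mult_left_mono) auto
  finally have c\<eta>: "c * T * \<eta> \<le> e / 8" by simp
  have "uniformly_continuous_on {0..\<tau>} r" "uniformly_continuous_on {0..\<tau>} (\<lambda>u. 1 / r u)"
    using cr ci by (auto intro: compact_uniformly_continuous)
  then obtain d1 d2 where d1: "d1 > 0" "\<And>s t. s \<in> {0..\<tau>} \<Longrightarrow> t \<in> {0..\<tau>} \<Longrightarrow> dist t s < d1 \<Longrightarrow> dist (r t) (r s) < e / 8"
    and d2: "d2 > 0" "\<And>s t. s \<in> {0..\<tau>} \<Longrightarrow> t \<in> {0..\<tau>} \<Longrightarrow> dist t s < d2 \<Longrightarrow> dist (1 / r t) (1 / r s) < \<eta>"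
    unfolding uniformly_continuous_on_def using \<eta> e
    by (metis (no_types, lifting) zero_less_divide_iff zero_less_numeral)
  define D where "D = min (min d1 d2) (e^2 / (8 * (c + 1)))"
  have D: "D > 0" using d1 d2 e c by (simp add: D_def)
  have "(\<lambda>n. T / real n) \<longlonglongrightarrow> 0" by (rule lim_const_over_n)
  then have "\<forall>\<^sub>F n in sequentially. T / real n < D" using D by (rule order_tendstoD)
  then show ?thesis
    using eventually_gt_at_top[of 0]
  proof eventually_elim
    fix n :: nat
    assume n: "T / real n < D" "0 < n"
    define d where "d = T / n"
    have d: "d > 0" "d < D" using n T by (auto simp: d_def)
    define Y where "Y = stopped_euler c d e x (\<lambda>i. b (d * Suc i) - b (d * i))"
    show "stopped_euler c (T / n) e x (\<lambda>i. b (T / n * Suc i) - b (T / n * i)) n \<le> e"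
    proof (rule ccontr)
      assume "\<not> ?thesis"
      then have "\<not> Y n \<le> e" by (simp add: Y_def d_def)
      then have above: "Y k > e" if "k \<le> n" for k
        using stopped_euler_absorbed[OF _ that] unfolding Y_def by (meson not_le)
      \<comment> \<open>\<open>d * K\<close> is the last grid point up to \<open>\<tau>\<close>.\<close>
      define K where "K = nat \<lfloor>\<tau> / d\<rfloor>"
      have K0: "real K \<le> \<tau> / d" "\<tau> / d < real K + 1"
        using \<tau> d by (auto simp: K_def)
      then have K1: "d * K \<le> \<tau>" "\<tau> < d * K + d"
        using d by (auto simp: field_simps)
      have "real K \<le> n"
      proof -
        have "\<tau> / d \<le> T / d" using \<tau> hit d by (intro divide_right_mono) auto
        also have "\<dots> = n" using T n by (simp add: d_def)
        finally show ?thesis using K0 by simp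
      qed
      then have Kn: "K \<le> n" by simp
      have "Y K \<le> r (d * K) + c * d / e + K * (c * d * \<eta>)"
      proof (rule euler_below_path[where K = K and \<tau> = \<tau> and b = b and r = r and x = x])
        show "1 / r s \<le> 1 / r t + \<eta>" if "0 \<le> s" "s \<le> t" "t \<le> \<tau>" "t \<le> s + d" for s t
          using d2(2)[of s t] that d by (auto simp: D_def dist_real_def)
        show "Y (Suc k) = Y k + c * d / Y k + (b (d * Suc k) - b (d * k))" if "k < K" for k
          using above[of k] that Kn by (simp add: Y_def euler_step_def)
        show "r t - r s = b t - b s + c * integral {s..t} (\<lambda>u. 1 / r u)"
          if "0 \<le> s" "s \<le> t" "t \<le> \<tau>" for s t
          using that by (rule eq')
        show "r t > 0" if "0 \<le> t" "t \<le> \<tau>" for t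
          using that by (rule pos)
        show "Y k > e" if "k < K" for k
          using that Kn by (intro above) simp
        show "Y 0 = x" by (simp add: Y_def)
      qed (use e c d \<eta> cr start K1 in simp_all)
      also have "r (d * K) \<le> e / 2 + e / 8"
      proof -
        have "dist (r (d * K)) (r \<tau>) < e / 8"
          using d1(2)[of \<tau> "d * K"] K1 \<tau> d by (auto simp: D_def dist_real_def)
        then show ?thesis using \<tau> unfolding dist_real_def by linarith
      qed
      also have "c * d / e \<le> e / 8"
      proof -
        have "d \<le> e^2 / (8 * (c + 1))" using d by (simp add: D_def)
        then have "c * d \<le> c * (e^2 / (8 * (c + 1)))" using c by (intro mult_left_mono) auto
        also have "\<dots> = (e^2 / 8) * (c / (c + 1))" by simp
        also have "\<dots> \<le> e^2 / 8 * 1" using c by (intro mult_left_mono) auto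
        finally show ?thesis using e by (simp add: field_simps power2_eq_square)
      qed
      also have "K * (c * d * \<eta>) \<le> e / 8"
      proof -
        have "d * K \<le> T" using K1 \<tau> hit by simp
        then have "(c * \<eta>) * (d * K) \<le> (c * \<eta>) * T" using c \<eta> by (intro mult_left_mono) auto
        then show ?thesis using c\<eta> by (simp add: algebra_simps)
      qed
      finally show False using above[OF Kn] e by simp
    qed
  qed
qed

section \<open>Bessel processes of dimension at least two do not hit zero\<close>

text \<open>Summed over the \<open>n\<close> steps of length \<open>T / n\<close>, the second-order errors are \<open>O(1 / n)\<close>. The bound on the
  right does not depend on \<open>e\<close>.\<close>

lemma (in standard_brownian_motion) euler_hit_prob_eventually_small:
  assumes e: "0 < e" "e \<le> 1" "e < x" and c: "c \<ge> 1/2" and T: "T > 0"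
  shows "\<forall>\<^sub>F n in sequentially.
    ln (1 / e) * prob {\<omega>\<in>space M. stopped_euler c (T / n) e x (increment (T / n) \<omega>) n \<le> e}
      \<le> x\<^sup>2 - ln x + (2 * c + 1) * T + 1"
proof -
  have "(\<lambda>n. T / real n) \<longlonglongrightarrow> 0" by (rule lim_const_over_n)
  then have "\<forall>\<^sub>F n in sequentially. T / real n < 1" by (rule order_tendstoD) simp
  moreover have "(\<lambda>n. (euler_error c e * T^2) / real n) \<longlonglongrightarrow> 0" by (rule lim_const_over_n)
  then have "\<forall>\<^sub>F n in sequentially. (euler_error c e * T^2) / real n < 1" by (rule order_tendstoD) simp
  ultimately show ?thesis
    using eventually_gt_at_top[of 0]
  proof eventually_elim
    case (elim n)
    have "ln (1 / e) * prob {\<omega>\<in>space M. stopped_euler c (T / n) e x (increment (T / n) \<omega>) n \<le> e}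
      \<le> barrier e x + n * ((2 * c + 1) * (T / n) + euler_error c e * (T / n)^2)"
      using elim T by (intro euler_hit_prob e c) auto
    also have "n * ((2 * c + 1) * (T / n) + euler_error c e * (T / n)^2)
        = (2 * c + 1) * T + (euler_error c e * T^2) / n"
      using elim by (simp add: field_simps power2_eq_square)
    also have "barrier e x = x\<^sup>2 - ln x"
      using e by (simp add: barrier_def max_def)
    finally show ?case using elim by linarith
  qed
qed

text \<open>For each \<open>j\<close> the event that \<open>A j n\<close> occurs for all large \<open>n\<close> has probability at most \<open>1 / (j + 1)\<close>. This
  covers an event \<open>P\<close> that need not be measurable.\<close>

lemma (in prob_space) AE_not_if_eventually_rare:
  assumes A: "\<And>j n. A j n \<in> events"
    and small: "\<And>j. \<forall>\<^sub>F n in sequentially. prob (A j n) \<le> 1 / real (Suc j)"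
    and sub: "AE \<omega> in M. P \<omega> \<longrightarrow> (\<forall>j. \<forall>\<^sub>F n in sequentially. \<omega> \<in> A j n)"
  shows "AE \<omega> in M. \<not> P \<omega>"
proof -
  define E where "E j = (\<Union>m. \<Inter>n\<in>{m..}. A j n)" for j
  have E: "E j \<in> events" for j
    unfolding E_def using A by (intro sets.countable_UN sets.countable_INT') auto
  have E_le: "prob (E j) \<le> 1 / real (Suc j)" for j
  proof -
    obtain N where N: "\<And>n. n \<ge> N \<Longrightarrow> prob (A j n) \<le> 1 / real (Suc j)"
      using small[of j] by (auto simp: eventually_sequentially)
    have ev: "(\<Inter>n\<in>{m..}. A j n) \<in> events" for m
      using A by (intro sets.countable_INT') auto
    have "(\<lambda>m. prob (\<Inter>n\<in>{m..}. A j n)) \<longlonglongrightarrow> prob (E j)"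
      unfolding E_def using ev
      by (intro finite_Lim_measure_incseq) (auto simp: incseq_def intro: order_trans)
    moreover have "prob (\<Inter>n\<in>{m..}. A j n) \<le> 1 / real (Suc j)" for m
    proof -
      have "prob (\<Inter>n\<in>{m..}. A j n) \<le> prob (A j (max m N))"
        by (intro finite_measure_mono A) auto
      also have "\<dots> \<le> 1 / real (Suc j)" by (intro N) auto
      finally show ?thesis .
    qed
    ultimately show ?thesis by (intro LIMSEQ_le_const2) auto
  qed
  define F where "F = (\<Inter>j. E j)"
  have F: "F \<in> events" unfolding F_def using E by auto
  have "prob F \<le> 1 / real (Suc j)" for j
  proof -
    have "prob F \<le> prob (E j)" by (intro finite_measure_mono E) (auto simp: F_def)
    with E_le[of j] show ?thesis by simp
  qed
  then have "prob F \<le> 0"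
    by (intro LIMSEQ_le_const[OF lim_1_over_n[THEN LIMSEQ_Suc]]) auto
  then have "prob F = 0" using measure_nonneg[of M F] by linarith
  then have "AE \<omega> in M. \<omega> \<notin> F"
    using F by (simp add: AE_iff_null_sets[symmetric] null_sets_def emeasure_eq_measure AE_not_in)
  with sub show ?thesis
  proof eventually_elim
    case (elim \<omega>)
    show ?case
    proof
      assume "P \<omega>"
      then have ev: "\<forall>j. \<exists>m. \<forall>n\<ge>m. \<omega> \<in> A j n"
        using elim(1) by (simp add: eventually_sequentially)
      have "\<omega> \<in> E j" for j
        using ev[rule_format, of j] unfolding E_def by blast
      then show False using elim(2) by (simp add: F_def)
    qed
  qed
qed

text \<open>On a positive path the integrand is continuous, so the Lebesgue and gauge integrals coincide and the
  fundamental theorem of calculus is available for the latter.\<close>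

lemma bessel_equation_integral:
  fixes X :: "real \<Rightarrow> real"
  assumes cont: "continuous_on {0..} X" and pos: "\<And>s. 0 \<le> s \<Longrightarrow> s \<le> t \<Longrightarrow> X s > 0"
  shows "(LBINT s:{0..t}. 1 / X s) = integral {0..t} (\<lambda>s. 1 / X s)"
proof (rule set_borel_integral_eq_integral)
  show "set_integrable lborel {0..t} (\<lambda>s. 1 / X s)"
    unfolding set_integrable_def
    using pos
    by (intro borel_integrable_compact continuous_intros continuous_on_subset[OF cont])
      (auto simp: less_imp_neq[symmetric])
qed

text \<open>If \<open>0\<close> is hit before \<open>T\<close>, then for every level \<open>e\<close> all fine Euler schemes stop before \<open>T\<close>, and this has
  small probability for small \<open>e\<close>. The equation for \<open>X\<close> enters pathwise only: all randomness is in the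
  increments of \<open>\<beta>\<close>.\<close>

lemma (in standard_brownian_motion) bessel_process_positive:
  assumes X: "bessel_process M \<beta> \<delta> x X" and \<delta>: "\<delta> \<ge> 2" and x: "x > 0"
  shows "AE \<omega> in M. \<forall>t\<ge>0. X t \<omega> > 0"
proof -
  define c where "c = (\<delta> - 1) / 2"
  have c: "c \<ge> 1/2" using \<delta> by (simp add: c_def)
  have "AE \<omega> in M. \<not> (\<exists>t\<in>{0..T}. X t \<omega> \<le> 0)" if T: "T > 0" for T :: real
  proof -
    \<comment> \<open>The level \<open>e j\<close> is so small that \<open>ln (1 / e j)\<close> is at least \<open>j + 1\<close> times the bound on the expectation.\<close>
    define B where "B = \<bar>x\<^sup>2 - ln x + (2 * c + 1) * T + 1\<bar>"
    define e where "e j = min (x / 2) (exp (- ((B + 1) * real (Suc j))))" for j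
    have e: "0 < e j" "e j \<le> 1" "e j < x" for j
    proof -
      have "0 \<le> (B + 1) * real (Suc j)" by (intro mult_nonneg_nonneg) (auto simp: B_def)
      then have "exp (- ((B + 1) * real (Suc j))) \<le> 1" by simp
      then show "e j \<le> 1" unfolding e_def by (rule min.coboundedI2)
    qed (use x in \<open>auto simp: e_def\<close>)
    have e_ln: "ln (1 / e j) \<ge> (B + 1) * real (Suc j)" for j
    proof -
      have "ln (e j) \<le> ln (exp (- ((B + 1) * real (Suc j))))"
        using e(1)[of j] by (intro ln_mono) (auto simp: e_def)
      then show ?thesis using e(1)[of j] by (simp add: ln_div algebra_simps)
    qed
    define A where "A j n = {\<omega>\<in>space M.
      stopped_euler c (T / real n) (e j) x (increment (T / real n) \<omega>) n \<le> e j}" for j n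
    show ?thesis
    proof (rule AE_not_if_eventually_rare)
      show "A j n \<in> events" for j n
      proof -
        have [measurable]: "(\<lambda>\<omega>. stopped_euler c (T / real n) (e j) x (increment (T / real n) \<omega>) n) \<in> borel_measurable M"
          using T by (intro euler_random_variable) auto
        show ?thesis unfolding A_def by measurable
      qed
      show "\<forall>\<^sub>F n in sequentially. prob (A j n) \<le> 1 / real (Suc j)" for j
        using euler_hit_prob_eventually_small[OF e(1)[of j] e(2)[of j] e(3)[of j] c T]
      proof eventually_elim
        case (elim n)
        have B: "B + 1 > 0" by (simp add: B_def)
        have "(B + 1) * (real (Suc j) * prob (A j n)) \<le> ln (1 / e j) * prob (A j n)"
          using mult_right_mono[OF e_ln[of j] measure_nonneg[of M "A j n"]] by (simp add: mult.assoc)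
        also have "\<dots> \<le> x\<^sup>2 - ln x + (2 * c + 1) * T + 1" using elim unfolding A_def .
        also have "\<dots> \<le> B" unfolding B_def by (rule abs_ge_self)
        also have "B \<le> (B + 1) * 1" by simp
        finally have "real (Suc j) * prob (A j n) \<le> 1" using B by (simp only: mult_le_cancel_left_pos)
        then show ?case by (simp add: field_simps)
      qed
      have "AE \<omega> in M. continuous_on {0..} (\<lambda>t. X t \<omega>) \<and>
          (\<forall>t\<ge>0. X t \<omega> = x + \<beta> t \<omega> + c * (LBINT s:{0..t}. 1 / X s \<omega>))"
        using X unfolding bessel_process_def c_def by auto
      then show "AE \<omega> in M. (\<exists>t\<in>{0..T}. X t \<omega> \<le> 0) \<longrightarrow> (\<forall>j. \<forall>\<^sub>F n in sequentially. \<omega> \<in> A j n)"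
        using start AE_space
      proof eventually_elim
        case (elim \<omega>)
        show ?case
        proof (intro impI allI)
          fix j
          assume "\<exists>t\<in>{0..T}. X t \<omega> \<le> 0"
          then obtain t where t: "0 \<le> t" "t \<le> T" "X t \<omega> \<le> 0" by auto
          have "\<forall>\<^sub>F n in sequentially. stopped_euler c (T / n) (e j) x
              (\<lambda>i. \<beta> (T / n * Suc i) \<omega> - \<beta> (T / n * i) \<omega>) n \<le> e j"
          proof (rule euler_hits_if_path_hits[of "e j" x c T "\<lambda>t. X t \<omega>" "\<lambda>t. \<beta> t \<omega>" t])
            have "AE s in lborel. indicator {0..0} s *\<^sub>R (1 / X s \<omega>) = 0"
              using AE_lborel_singleton[of "0 :: real"] by eventually_elim auto
            then have "(LBINT s:{0..0}. 1 / X s \<omega>) = 0"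
              unfolding set_lebesgue_integral_def by (rule integral_eq_zero_AE)
            with elim show "X 0 \<omega> = x" by auto
            show "X t \<omega> = x + \<beta> t \<omega> + c * integral {0..t} (\<lambda>u. 1 / X u \<omega>)"
              if "0 \<le> t" "t \<le> T" "\<And>s. 0 \<le> s \<Longrightarrow> s \<le> t \<Longrightarrow> X s \<omega> > 0" for t
              using bessel_equation_integral[of "\<lambda>t. X t \<omega>" t] elim that by simp
          qed (use e[of j] c T t elim in auto)
          then show "\<forall>\<^sub>F n in sequentially. \<omega> \<in> A j n"
            using elim by (simp add: A_def increment_def[abs_def])
        qed
      qed
    qed
  qed
  then have "AE \<omega> in M. \<forall>m::nat. \<not> (\<exists>t\<in>{0..real (Suc m)}. X t \<omega> \<le> 0)"
    by (subst AE_all_countable) auto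
  then show ?thesis
  proof eventually_elim
    case (elim \<omega>)
    show ?case
    proof (intro allI impI)
      fix t :: real
      assume t: "t \<ge> 0"
      obtain m :: nat where "t \<le> m" using real_arch_simple by blast
      then have "t \<in> {0..real (Suc m)}" using t by auto
      with elim show "X t \<omega> > 0" by force
    qed
  qed
qed

section \<open>From rational starting points to all starting points\<close>

text \<open>Solutions with rational starting points are ordered like their starting points, by
  \<open>difference_of_solutions\<close>. So for rational \<open>q < x\<close> the value at \<open>x\<close>, a limit of values at rationals above
  \<open>q\<close>, is at least the positive value at \<open>q\<close>. Once \<open>R\<close> is positive everywhere, \<open>1 / R\<close> is continuous and
  the equation passes to the limit.\<close>

lemma flow_equation_from_rationals:
  fixes R :: "real \<Rightarrow> real \<Rightarrow> real" and b :: "real \<Rightarrow> real" and c :: real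
  assumes cont: "continuous_on ({0<..} \<times> {0..}) (\<lambda>(x, t). R x t)"
    and pos: "\<And>q t. q \<in> \<rat> \<Longrightarrow> q > 0 \<Longrightarrow> t \<ge> 0 \<Longrightarrow> R q t > 0"
    and eq: "\<And>q t. q \<in> \<rat> \<Longrightarrow> q > 0 \<Longrightarrow> t \<ge> 0 \<Longrightarrow> R q t = q + b t + c * integral {0..t} (\<lambda>s. 1 / R q s)"
  shows "x > 0 \<Longrightarrow> t \<ge> 0 \<Longrightarrow> R x t > 0" (is "PROP ?pos")
    and "x > 0 \<Longrightarrow> t \<ge> 0 \<Longrightarrow> R x t = x + b t + c * integral {0..t} (\<lambda>s. 1 / R x s)" (is "PROP ?eq")
proof -
  have sec: "continuous_on {0..} (R y)" if "y > 0" for y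
    using space_smooth_continuous_section[of 0 R y] cont that by simp
  have secx: "continuous_on {0<..} (\<lambda>y. R y t)" if "t \<ge> 0" for t
    by (rule continuous_on_compose2[OF cont[unfolded split_beta], of _ "\<lambda>y. (y, t)", simplified])
      (use that in \<open>auto intro!: continuous_intros\<close>)
  have rat_seq: "\<exists>f. (\<forall>n. f n \<in> \<rat> \<and> f n > q) \<and> f \<longlonglongrightarrow> x" if "x > q" for q x :: real
  proof -
    have "\<exists>r\<in>\<rat>. max q (x - 1 / real (Suc n)) < r \<and> r < x" for n
      by (rule Rats_dense_in_real) (use that in auto)
    then obtain f where f: "\<And>n. f n \<in> \<rat> \<and> max q (x - 1 / real (Suc n)) < f n \<and> f n < x"
      by metis
    have "f \<longlonglongrightarrow> x"
    proof (rule tendsto_sandwich)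
      show "\<forall>\<^sub>F n in sequentially. x - 1 / real (Suc n) \<le> f n" "\<forall>\<^sub>F n in sequentially. f n \<le> x"
        using f by (auto intro!: always_eventually less_imp_le)
      have "(\<lambda>n. x - 1 / real (Suc n)) \<longlonglongrightarrow> x - 0"
        by (intro tendsto_diff tendsto_const LIMSEQ_Suc[OF lim_1_over_n])
      then show "(\<lambda>n. x - 1 / real (Suc n)) \<longlonglongrightarrow> x" by simp
    qed simp
    with f show ?thesis by (metis max_less_iff_conj)
  qed
  have P: "R x t > 0" if x: "x > 0" and t: "t \<ge> 0" for x t
  proof -
    obtain q where q: "q \<in> \<rat>" "0 < q" "q < x" using Rats_dense_in_real[OF x] by auto
    obtain f where f: "\<And>n. f n \<in> \<rat>" "\<And>n. f n > q" "f \<longlonglongrightarrow> x"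
      using rat_seq[OF q(3)] by auto
    have "(\<lambda>n. R (f n) t) \<longlonglongrightarrow> R x t"
      by (rule continuous_on_tendsto_compose[OF secx[OF t] f(3)])
        (use x f q in \<open>auto intro!: always_eventually intro: less_trans\<close>)
    moreover have "R q t \<le> R (f n) t" for n
    proof -
      have fn: "f n > 0" using f(2)[of n] q by linarith
      have "R (f n) t - R q t = (f n - q) * exp (- c * integral {0..t} (\<lambda>s. 1 / (R q s * R (f n) s)))"
        by (rule difference_of_solutions[where b = b]) (use q f fn pos eq sec t in auto)
      moreover have "(f n - q) * exp (- c * integral {0..t} (\<lambda>s. 1 / (R q s * R (f n) s))) \<ge> 0"
        using f(2)[of n] by (intro mult_nonneg_nonneg) auto
      ultimately show ?thesis by linarith
    qed
    ultimately have "R q t \<le> R x t" by (intro LIMSEQ_le_const) auto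
    with pos[of q t] q t show ?thesis by linarith
  qed
  then show "PROP ?pos" .
  show "PROP ?eq"
  proof -
    assume x: "x > 0" and t: "t \<ge> 0"
    have "continuous_on ({0<..} \<times> cbox 0 t) (\<lambda>(y, s). 1 / R y s)"
      unfolding split_beta
      by (intro continuous_intros continuous_on_subset[OF cont[unfolded split_beta]])
        (use P in \<open>auto simp: less_imp_neq[symmetric]\<close>)
    then have ci: "continuous_on {0<..} (\<lambda>y. integral {0..t} (\<lambda>s. 1 / R y s))"
      using integral_continuous_on_param[of "{0<..}" 0 t "\<lambda>y s. 1 / R y s"] by simp
    obtain f where f: "\<And>n. f n \<in> \<rat>" "\<And>n. f n > 0" "f \<longlonglongrightarrow> x"
      using rat_seq[OF x] by auto
    have "(\<lambda>n. R (f n) t) \<longlonglongrightarrow> R x t"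
      by (rule continuous_on_tendsto_compose[OF secx[OF t] f(3)])
        (use x f in \<open>auto intro!: always_eventually\<close>)
    moreover have "(\<lambda>n. integral {0..t} (\<lambda>s. 1 / R (f n) s)) \<longlonglongrightarrow> integral {0..t} (\<lambda>s. 1 / R x s)"
      by (rule continuous_on_tendsto_compose[OF ci f(3)])
        (use x f in \<open>auto intro!: always_eventually\<close>)
    then have "(\<lambda>n. f n + b t + c * integral {0..t} (\<lambda>s. 1 / R (f n) s))
        \<longlonglongrightarrow> x + b t + c * integral {0..t} (\<lambda>s. 1 / R x s)"
      by (intro tendsto_intros f(3))
    then have "(\<lambda>n. R (f n) t) \<longlonglongrightarrow> x + b t + c * integral {0..t} (\<lambda>s. 1 / R x s)"
      using eq[OF f(1) f(2) t] by simp
    ultimately show "R x t = x + b t + c * integral {0..t} (\<lambda>s. 1 / R x s)"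
      by (rule LIMSEQ_unique)
  qed
qed

section \<open>Smoothness of the Bessel flow\<close>

theorem theorem1p1:
  fixes M :: "'a measure" and \<beta> :: "real \<Rightarrow> 'a \<Rightarrow> real"
    and \<delta> :: real and \<rho> :: "real \<Rightarrow> real \<Rightarrow> 'a \<Rightarrow> real"
  assumes "standard_brownian_motion M \<beta>"
    and "\<delta> \<ge> 2"
    and "bicontinuous_bessel_flow M \<beta> \<delta> \<rho>"
  shows "AE \<omega> in M. \<forall>n.
    (\<forall>x>0. \<forall>t\<ge>0. (deriv ^^ n) (\<lambda>y. \<rho> y t \<omega>) field_differentiable at x) \<and>
    continuous_on ({0<..} \<times> {0..}) (\<lambda>(x, t). (deriv ^^ n) (\<lambda>y. \<rho> y t \<omega>) x)"
proof -
  interpret standard_brownian_motion M \<beta> by fact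
  define c where "c = (\<delta> - 1) / 2"
  have flow: "bessel_process M \<beta> \<delta> x (\<rho> x)" if "x \<ge> 0" for x
    using assms(3) that by (auto simp: bicontinuous_bessel_flow_def)
  have "AE \<omega> in M. continuous_on ({0..} \<times> {0..}) (\<lambda>(x, t). \<rho> x t \<omega>)"
    using assms(3) by (auto simp: bicontinuous_bessel_flow_def)
  moreover have "AE \<omega> in M. \<forall>q\<in>\<rat> \<inter> {0<..}. \<forall>t\<ge>0. \<rho> q t \<omega> > 0"
    using bessel_process_positive[OF flow assms(2)]
    by (subst AE_ball_countable) (auto intro: countable_rat countable_subset)
  moreover have "AE \<omega> in M. \<forall>q\<in>\<rat> \<inter> {0<..}. \<forall>t\<ge>0.
      \<rho> q t \<omega> = q + \<beta> t \<omega> + c * (LBINT s:{0..t}. 1 / \<rho> q s \<omega>)"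
  proof (subst AE_ball_countable)
    show "countable (\<rat> \<inter> {0<..} :: real set)" by (auto intro: countable_rat countable_subset)
    show "\<forall>q\<in>\<rat> \<inter> {0<..}. AE \<omega> in M. \<forall>t\<ge>0.
      \<rho> q t \<omega> = q + \<beta> t \<omega> + c * (LBINT s:{0..t}. 1 / \<rho> q s \<omega>)"
    proof
      fix q :: real assume "q \<in> \<rat> \<inter> {0<..}"
      then have "bessel_process M \<beta> \<delta> q (\<rho> q)" by (intro flow) auto
      then show "AE \<omega> in M. \<forall>t\<ge>0. \<rho> q t \<omega> = q + \<beta> t \<omega> + c * (LBINT s:{0..t}. 1 / \<rho> q s \<omega>)"
        unfolding bessel_process_def c_def by auto
    qed
  qed
  ultimately show ?thesis
  proof eventually_elim
    case (elim \<omega>)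
    let ?R = "\<lambda>x t. \<rho> x t \<omega>"
    have cont: "continuous_on ({0<..} \<times> {0..}) (\<lambda>(x, t). ?R x t)"
      using elim(1) by (rule continuous_on_subset) auto
    have sec: "continuous_on {0..} (?R y)" if "y > 0" for y
      using space_smooth_continuous_section[of 0 ?R y] cont that by simp
    have pos: "?R q t > 0" if "q \<in> \<rat>" "q > 0" "t \<ge> 0" for q t
      using elim(2) that by auto
    have eq: "?R q t = q + \<beta> t \<omega> + c * integral {0..t} (\<lambda>s. 1 / ?R q s)"
      if "q \<in> \<rat>" "q > 0" "t \<ge> 0" for q t
      using elim(3) that bessel_equation_integral[OF sec[of q], of t] pos by auto
    note R = flow_equation_from_rationals[where R = ?R and b = "\<lambda>t. \<beta> t \<omega>" and c = c, OF cont pos eq]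
    show ?case
      by (rule all_space_smooth_imp_derivatives[of ?R],
          rule positive_flow_smooth[where b = "\<lambda>t. \<beta> t \<omega>" and c = c, OF cont R])
  qed
qed

end
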